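(* Let $d$ and $n$ be positive integers with $d>2$ and $n\equiv -1\pmod d$. Then \[ \sum_{k=0}^{n-1}[2dk+1]\frac{(q;q^d)_k^4}{(q^d;q^d)_k^4}\,q^{(d-2)k} \equiv 0\pmod{[n]\Phi_n(q)}. \]
   Context: Here $q$ is an indeterminate. For $x$ and a base $p$ (a power of $q$), $(x;p)_k=\prod_{j=0}^{k-1}(1-xp^j)$ for integers $k\ge 0$. The $q$-integer is $[m]=1+q+\cdots+q^{m-1}$, and $\Phi_n(q)$ is the $n$-th cyclotomic polynomial. For rational functions $A(q),B(q)$ and a polynomial $P(q)$, $A(q)\equiv B(q)\pmod{P(q)}$ means that the numerator of the reduced form of $A(q)-B(q)$ is divisible by $P(q)$ in $\mathbb{Z}[q]$. *)

theory Defs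
  imports
    "HOL-Computational_Algebra.Computational_Algebra"
    "HOL-Number_Theory.Cong"
    Complex_Main
begin

definition q_pochhammer :: "'a::comm_ring_1 \<Rightarrow> 'a \<Rightarrow> nat \<Rightarrow> 'a" where
  "q_pochhammer x p k = (\<Prod>j<k. 1 - x * p ^ j)"

definition q_int :: "'a::comm_ring_1 \<Rightarrow> nat \<Rightarrow> 'a" where
  "q_int q m = (\<Sum>i<m. q ^ i)"

definition primitive_roots_of_unity :: "nat \<Rightarrow> complex set" where
  "primitive_roots_of_unity n = {z. z ^ n = 1 \<and> (\<forall>m. 0 < m \<and> m < n \<longrightarrow> z ^ m \<noteq> 1)}"

text \<open>
  The cyclotomic polynomial is the monic polynomial whose roots are the primitive roots of
  unity, each of them simple. The product below has complex coefficients; it descends to a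
  unique integer polynomial (lemma \<open>of_int_cyclotomic\<close>). Only positive indices are meaningful.
\<close>

definition cyclotomic :: "nat \<Rightarrow> int poly" where
  "cyclotomic n =
     (THE p. map_poly of_int p = (\<Prod>z\<in>primitive_roots_of_unity n. [:- z, 1:]))"

text \<open>
  Rational functions in an indeterminate with rational coefficients form the field of fractions
  of the ring of integer polynomials, so they are represented by the type \<open>int poly fract\<close>.
\<close>

definition poly_q :: "int poly" where
  "poly_q = [:0, 1:]"

definition ratfun_q :: "int poly fract" where
  "ratfun_q = Fract poly_q 1"

text \<open>
  \<open>quot_of_fract\<close> returns the reduced numerator and denominator, i.e. a coprime pair.
\<close>

definition ratfun_cong :: "int poly fract \<Rightarrow> int poly fract \<Rightarrow> int poly \<Rightarrow> bool" where
  "ratfun_cong A B P \<longleftrightarrow> P dvd fst (quot_of_fract (A - B))"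


subsection \<open>Integrality of the cyclotomic polynomials\<close>

lemma map_poly_of_int_mult:
  "map_poly (of_int :: int \<Rightarrow> complex) (p * q) = map_poly of_int p * map_poly of_int q"
  by (rule poly_eqI) (simp add: coeff_map_poly coeff_mult)

lemma map_poly_of_int_add:
  "map_poly (of_int :: int \<Rightarrow> complex) (p + q) = map_poly of_int p + map_poly of_int q"
  by (rule poly_eqI) (simp add: coeff_map_poly)

lemma map_poly_of_int_prod:
  "map_poly (of_int :: int \<Rightarrow> complex) (\<Prod>x\<in>A. f x) = (\<Prod>x\<in>A. map_poly of_int (f x))"
  by (induction A rule: infinite_finite_induct) (simp_all add: map_poly_of_int_mult)

lemma map_poly_of_int_inj:
  "map_poly (of_int :: int \<Rightarrow> complex) p = map_poly of_int q \<longleftrightarrow> p = q"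
  by (auto simp: poly_eq_iff coeff_map_poly)

lemma finite_primitive_roots_of_unity:
  "n > 0 \<Longrightarrow> finite (primitive_roots_of_unity n)"
  by (rule finite_subset[OF _ finite_roots_unity[of n]])
     (auto simp: primitive_roots_of_unity_def)

lemma roots_of_unity_eq_UN_primitive:
  assumes "n > 0"
  shows "{z::complex. z ^ n = 1} = (\<Union>d\<in>{d. d dvd n}. primitive_roots_of_unity d)"
proof (intro equalityI subsetI)
  fix z :: complex assume "z \<in> {z. z ^ n = 1}"
  hence z: "z ^ n = 1" by simp
  define d where "d = (LEAST m. 0 < m \<and> z ^ m = 1)"
  have d: "0 < d \<and> z ^ d = 1"
    unfolding d_def by (rule LeastI[of _ n]) (use assms z in simp)
  have least: "z ^ m \<noteq> 1" if "0 < m" "m < d" for m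
    using not_less_Least[of m "\<lambda>m. 0 < m \<and> z ^ m = 1"] that unfolding d_def by blast
  have "z ^ (n mod d) = z ^ (d * (n div d) + n mod d)"
    using d by (simp only: power_add power_mult) simp
  also have "\<dots> = 1"
    using z by simp
  finally have "n mod d = 0"
    using least[of "n mod d"] d by (metis mod_less_divisor neq0_conv)
  hence "d dvd n" by auto
  moreover have "z \<in> primitive_roots_of_unity d"
    using d least by (auto simp: primitive_roots_of_unity_def)
  ultimately show "z \<in> (\<Union>d\<in>{d. d dvd n}. primitive_roots_of_unity d)" by blast
next
  fix z assume "z \<in> (\<Union>d\<in>{d. d dvd n}. primitive_roots_of_unity d)"
  thus "z \<in> {z. z ^ n = 1}"
    by (auto simp: primitive_roots_of_unity_def power_mult elim!: dvdE)
qed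

lemma prod_roots_of_unity:
  assumes "n > 0"
  shows "(\<Prod>z | z ^ n = 1. [:- z, 1:]) = (monom 1 n - 1 :: complex poly)"
proof -
  let ?p = "monom 1 n - 1 :: complex poly"
  have "rsquarefree ?p"
    unfolding rsquarefree_roots
    using assms by (auto simp: pderiv_diff pderiv_monom poly_monom power_0_left)
  hence "smult (lead_coeff ?p) (\<Prod>z | poly ?p z = 0. [:- z, 1:]) = ?p"
    by (rule complex_poly_decompose_rsquarefree)
  moreover have "lead_coeff ?p = 1"
  proof -
    have "degree ?p = n"
    proof (rule antisym)
      show "degree ?p \<le> n" by (intro degree_diff_le) (simp_all add: degree_monom_le)
      show "n \<le> degree ?p" using assms by (intro le_degree) simp
    qed
    thus ?thesis using assms by simp
  qed
  ultimately show ?thesis by (simp add: poly_monom)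
qed

lemma prod_primitive_roots_of_unity:
  assumes "n > 0"
  shows "(\<Prod>d | d dvd n. \<Prod>z\<in>primitive_roots_of_unity d. [:- z, 1:]) = monom 1 n - 1"
proof -
  have disj: "primitive_roots_of_unity i \<inter> primitive_roots_of_unity j = {}"
    if "i \<in> {d. d dvd n}" "j \<in> {d. d dvd n}" "i \<noteq> j" for i j
  proof -
    have "0 < i" "0 < j" using that assms by (auto intro: dvd_pos_nat)
    thus ?thesis using \<open>i \<noteq> j\<close>
      by (auto simp: primitive_roots_of_unity_def) (metis nat_neq_iff)
  qed
  have "(\<Prod>d | d dvd n. \<Prod>z\<in>primitive_roots_of_unity d. [:- z, 1:]) =
        (\<Prod>z\<in>(\<Union>d\<in>{d. d dvd n}. primitive_roots_of_unity d). [:- z, 1:])"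
    by (rule sym, rule prod.UNION_disjoint)
       (use assms disj in \<open>auto intro!: finite_primitive_roots_of_unity intro: dvd_pos_nat\<close>)
  also have "\<dots> = monom 1 n - 1"
    using prod_roots_of_unity[OF assms] roots_of_unity_eq_UN_primitive[OF assms] by simp
  finally show ?thesis .
qed

lemma cyclotomic_exists:
  assumes "n > 0"
  shows "\<exists>p. map_poly of_int p = (\<Prod>z\<in>primitive_roots_of_unity n. [:- z, 1:])"
  using assms
proof (induction n rule: less_induct)
  case (less n)
  let ?R = "\<lambda>d. \<Prod>z\<in>primitive_roots_of_unity d. [:- z, 1:]"
  define D where "D = {d. d dvd n} - {n}"
  have "\<forall>d\<in>D. \<exists>p. map_poly of_int p = ?R d"
    using less.prems by (auto simp: D_def intro!: less.IH dest: dvd_imp_le intro: dvd_pos_nat)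
  then obtain c where c: "map_poly of_int (c d) = ?R d" if "d \<in> D" for d
    by metis
  define P where "P = (\<Prod>d\<in>D. c d)"
  have P: "map_poly of_int P = (\<Prod>d\<in>D. ?R d)"
    unfolding P_def map_poly_of_int_prod by (rule prod.cong) (use c in auto)
  have deg: "degree (map_poly (of_int :: int \<Rightarrow> complex) p) = degree p" for p
    by (rule degree_map_poly) simp
  have "lead_coeff (map_poly (of_int :: int \<Rightarrow> complex) P) = 1"
    unfolding P by (simp add: lead_coeff_prod)
  hence monic: "lead_coeff P = 1"
    by (simp add: deg coeff_map_poly)
  hence "P \<noteq> 0" by auto
  obtain q r where qr: "pseudo_divmod (monom 1 n - 1) P = (q, r)"
    by fastforce
  have eq: "monom 1 n - 1 = P * q + r" and r: "r = 0 \<or> degree r < degree P"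
    using pseudo_divmod[OF \<open>P \<noteq> 0\<close> qr] monic by simp_all
  have map_eq: "map_poly (of_int :: int \<Rightarrow> complex) (monom 1 n - 1) = monom 1 n - 1"
    by (rule poly_eqI) (simp add: coeff_map_poly)
  have "map_poly of_int P * ?R n = monom 1 n - 1"
    unfolding P prod_primitive_roots_of_unity[OF less.prems, symmetric] D_def
    using less.prems by (subst (2) prod.remove[of _ n]) (auto simp: mult.commute)
  also have "\<dots> = map_poly of_int P * map_poly of_int q + map_poly of_int r"
    unfolding map_eq[symmetric] eq by (simp add: map_poly_of_int_add map_poly_of_int_mult)
  finally have r_eq: "map_poly of_int P * (?R n - map_poly of_int q) = map_poly of_int r"
    by (simp add: algebra_simps)
  have "?R n - map_poly of_int q = 0"
  proof (rule ccontr)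
    assume nz: "?R n - map_poly of_int q \<noteq> 0"
    have nzP: "map_poly (of_int :: int \<Rightarrow> complex) P \<noteq> 0"
      using \<open>P \<noteq> 0\<close> map_poly_of_int_inj[of P 0] by simp
    have "degree P \<le> degree r" "r \<noteq> 0"
      using degree_mult_eq[OF nzP nz] nz nzP r_eq by (auto simp: deg)
    with r show False by simp
  qed
  thus ?case by (intro exI[of _ q]) simp
qed

lemma of_int_cyclotomic:
  assumes "n > 0"
  shows "map_poly of_int (cyclotomic n) = (\<Prod>z\<in>primitive_roots_of_unity n. [:- z, 1:])"
proof -
  have "\<exists>!p. map_poly of_int p = (\<Prod>z\<in>primitive_roots_of_unity n. [:- z, 1:])"
    using cyclotomic_exists[OF assms] map_poly_of_int_inj by metis
  thus ?thesis unfolding cyclotomic_def by (rule theI')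
qed

end

theory Submission
  imports Defs
begin

text \<open>
  Put $p = q^d$ and $X = q^{cm}$, where $m > 1$ is coprime to $d$ and $cm = dN + 1$ with $N < m$.
  Since $(1 - X q^a)(1 - q^a / X) = (1 - q^a)^2 - q^a (1 - X)^2 / X$ and $\Phi_m$ divides $1 - X$,
  replacing $(q;p)_k^2$ by $(Xq;p)_k (q/X;p)_k$ and $(p;p)_k^2$ by $(pX;p)_k (p/X;p)_k$ changes the
  $k$-th summand, for $k < m$, only by a multiple of $\Phi_m^2$. The modified sum over $k < m$ is a
  terminating very-well-poised ${}_6\phi_5$, with value
  $(pq;p)_N (p/(qX);p)_N / ((p/X;p)_N (p;p)_N)$. The factor $1 - q^{dN+1}$ of $(pq;p)_N$ gives one
  $\Phi_m$; for $m = n$, $c = d - 1$, the second numerator symbol contains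
  $1 - q^{(1 - c) n}$ and gives another one.

  For a proper divisor $m$ of $n$ the summation range splits into blocks of length $m$. Modulo
  $\Phi_m$ the block starting at $um$ is the block starting at $0$, multiplied by the fourth power
  of $(q;p)_{um} / (p;p)_{um}$, which has no $\Phi_m$ in its denominator.
\<close>

section \<open>A terminating very-well-poised series\<close>

lemma q_pochhammer_0 [simp]: "q_pochhammer x p 0 = 1"
  by (simp add: q_pochhammer_def)

lemma q_pochhammer_Suc: "q_pochhammer x p (Suc k) = q_pochhammer x p k * (1 - x * p ^ k)"
  by (simp add: q_pochhammer_def)

lemma q_pochhammer_Suc_left: "q_pochhammer x p (Suc k) = (1 - x) * q_pochhammer (x * p) p k"
  unfolding q_pochhammer_def by (subst prod.lessThan_Suc_shift) (simp add: mult.assoc)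

text \<open>
  The term of the very-well-poised ${}_6\phi_5$ series with parameters $a, b, c, e$,
  where $b = 1/y$: the factors $(1/y; p)_k\, y^k$ are written as $\prod_{i<k} (y - p^i)$, so that
  the terminating case $b = p^{-N}$ is $y = p^N$.
\<close>

definition sixphifive_term :: "'a::field \<Rightarrow> 'a \<Rightarrow> 'a \<Rightarrow> 'a \<Rightarrow> 'a \<Rightarrow> nat \<Rightarrow> 'a" where
  "sixphifive_term p a c e y k =
     (1 - a * p ^ (2 * k))
     * (q_pochhammer a p k * q_pochhammer c p k * q_pochhammer e p k * (a * p / (c * e)) ^ k)
     * (\<Prod>i<k. y - p ^ i)
     / (q_pochhammer p p k * q_pochhammer (a * p / c) p k * q_pochhammer (a * p / e) p k
        * q_pochhammer (a * p * y) p k)"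

text \<open>
  The right-hand side is the WZ certificate of Rogers' summation formula: replacing $y$ by $p y$
  is the step from $N$ to $N + 1$, and for $y = p^N$ the certificate vanishes as soon as $K > N$.
\<close>

lemma sixphifive_telescope:
  fixes a c e p y :: "'a::field"
  assumes nz: "p \<noteq> 0" "c \<noteq> 0" "e \<noteq> 0"
    and den: "\<And>k. q_pochhammer p p k \<noteq> 0" "\<And>k. q_pochhammer (a * p / c) p k \<noteq> 0"
      "\<And>k. q_pochhammer (a * p / e) p k \<noteq> 0" "\<And>k. q_pochhammer (a * p * y) p k \<noteq> 0"
  shows "(1 - a * p * y / c) * (1 - a * p * y / e) * (\<Sum>k\<le>K. sixphifive_term p a c e (p * y) k)
       - (1 - a * p * y) * (1 - a * p * y / (c * e)) * (\<Sum>k\<le>K. sixphifive_term p a c e y k)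
       = y * (1 - a * p * y)
         * (q_pochhammer a p (Suc K) * q_pochhammer c p (Suc K) * q_pochhammer e p (Suc K)
            * (a * p / (c * e)) ^ Suc K)
         * (\<Prod>i<K. y - p ^ i)
         / (q_pochhammer p p K * q_pochhammer (a * p / c) p K * q_pochhammer (a * p / e) p K
            * q_pochhammer (a * p * y) p (Suc K))"
proof (induction K)
  case 0
  have "1 - a * p * y \<noteq> 0"
    using den(4)[of 1] by (simp add: q_pochhammer_Suc)
  then show ?case
    using nz by (simp add: sixphifive_term_def q_pochhammer_Suc field_simps)
next
  case (Suc j)
  define num where "num k = q_pochhammer a p k * q_pochhammer c p k * q_pochhammer e p k
            * (a * p / (c * e)) ^ k" for k
  define dn where "dn k = q_pochhammer p p k * q_pochhammer (a * p / c) p k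
            * q_pochhammer (a * p / e) p k" for k
  define v where "v k = (\<Prod>i<k. y - p ^ i)" for k
  define w where "w k = q_pochhammer (a * p * y) p k" for k
  define P where "P = p ^ j"
  \<comment> \<open>\<open>Q\<close> is the common factor of the two new terms and of the
    certificate at \<open>j\<close> and at \<open>Suc j\<close>. After it is taken out, only a
    polynomial identity in the remaining factors is left to prove.\<close>
  define Q where "Q = num (Suc j) * v j / (dn (Suc j) * w (Suc (Suc j)))"
  have w_nz: "w k \<noteq> 0" and dn_nz: "dn k \<noteq> 0" for k
    using den by (auto simp: w_def dn_def)
  \<comment> \<open>The first factor of the product for \<open>p * y\<close> stands alone. Each of
    the others yields a factor \<open>p\<close> and becomes a factor of the product for
    \<open>y\<close>. Likewise \<open>w'\<close> splits off the first factor of the symbol for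
    \<open>y\<close>, leaving the symbol for \<open>p * y\<close>.\<close>
  have v': "(\<Prod>i<Suc j. p * y - p ^ i) = (p * y - 1) * P * v j"
  proof -
    have "(\<Prod>i<Suc j. p * y - p ^ i) = (p * y - 1) * (\<Prod>i<j. p * (y - p ^ i))"
      by (subst prod.lessThan_Suc_shift) (simp add: algebra_simps)
    then show ?thesis by (simp add: prod.distrib P_def v_def)
  qed
  have w': "w (Suc (Suc j)) = (1 - a * p * y) * q_pochhammer (a * p * (p * y)) p (Suc j)"
    unfolding w_def by (subst q_pochhammer_Suc_left) (simp add: mult_ac)
  have num_Suc: "num (Suc k) = num k * ((1 - a * p ^ k) * (1 - c * p ^ k) * (1 - e * p ^ k)
                   * (a * p / (c * e)))" for k
    by (simp add: num_def q_pochhammer_Suc mult_ac)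
  have dn_Suc: "dn (Suc j) = dn j * ((1 - p * P) * (1 - a * p * P / c) * (1 - a * p * P / e))"
    by (simp add: dn_def q_pochhammer_Suc mult_ac P_def)
  have w_Suc: "w (Suc (Suc j)) = w (Suc j) * (1 - a * p * y * (p * P))"
    by (simp add: w_def q_pochhammer_Suc[of _ _ "Suc j"] P_def)
  have v_Suc: "v (Suc j) = v j * (y - P)" by (simp add: v_def P_def)
  have t1: "sixphifive_term p a c e (p * y) (Suc j)
      = (1 - a * (p * P)^2) * (p * y - 1) * P * (1 - a * p * y) * Q"
  proof -
    have "1 - a * p * y \<noteq> 0" "q_pochhammer (a * p * (p * y)) p (Suc j) \<noteq> 0"
      using w' w_nz[of "Suc (Suc j)"] by auto
    moreover have "p ^ (2 * Suc j) = (p * P)^2"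
      by (simp add: P_def power2_eq_square power_add mult_2)
    ultimately show ?thesis
      unfolding sixphifive_term_def v' num_def[symmetric] dn_def[symmetric] Q_def w'
      by simp
  qed
  have t2: "sixphifive_term p a c e y (Suc j)
      = (1 - a * (p * P)^2) * (y - P) * (1 - a * p * y * (p * P)) * Q"
  proof -
    have "p ^ (2 * Suc j) = (p * P)^2"
      by (simp add: P_def power2_eq_square power_add mult_2)
    moreover have "1 - a * p * y * (p * P) \<noteq> 0"
      using w_Suc w_nz[of "Suc (Suc j)"] by auto
    ultimately show ?thesis
      unfolding sixphifive_term_def num_def[symmetric] dn_def[symmetric] Q_def w_Suc
        v_def[symmetric] w_def[symmetric] v_Suc by simp
  qed
  have g1: "y * (1 - a * p * y) * num (Suc j) * v j / (dn j * w (Suc j))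
      = y * (1 - a * p * y) * ((1 - p * P) * (1 - a * p * P / c) * (1 - a * p * P / e))
        * (1 - a * p * y * (p * P)) * Q"
  proof -
    have *: "1 - a * p * y * (p * P) \<noteq> 0"
      using w_Suc w_nz[of "Suc (Suc j)"] by auto
    have "(1 - p * P) * (1 - a * p * P / c) * (1 - a * p * P / e) \<noteq> 0"
      using dn_Suc dn_nz[of "Suc j"] by auto
    with * nz show ?thesis
      unfolding Q_def w_Suc dn_Suc by simp
  qed
  have g2: "y * (1 - a * p * y) * num (Suc (Suc j)) * v (Suc j) / (dn (Suc j) * w (Suc (Suc j)))
      = y * (1 - a * p * y) * ((1 - a * (p * P)) * (1 - c * (p * P)) * (1 - e * (p * P))
                   * (a * p / (c * e))) * (y - P) * Q"
    unfolding Q_def num_Suc[of "Suc j"] v_Suc by (simp add: P_def)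
  have key: "(1 - a * p * y / c) * (1 - a * p * y / e)
        * ((1 - a * (p * P)^2) * (p * y - 1) * P * (1 - a * p * y))
      - (1 - a * p * y) * (1 - a * p * y / (c * e))
        * ((1 - a * (p * P)^2) * (y - P) * (1 - a * p * y * (p * P)))
      = y * (1 - a * p * y) * ((1 - a * (p * P)) * (1 - c * (p * P)) * (1 - e * (p * P))
                   * (a * p / (c * e))) * (y - P)
      - y * (1 - a * p * y) * ((1 - p * P) * (1 - a * p * P / c) * (1 - a * p * P / e))
        * (1 - a * p * y * (p * P))"
  proof -
    \<comment> \<open>With the reciprocals as separate variables the claim is a polynomial identity
      modulo \<open>c * c' = 1\<close> and \<open>e * e' = 1\<close>, within reach of
      \<open>algebra\<close>.\<close>
    define c' e' where "c' = 1 / c" and "e' = 1 / e"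
    have ce: "c * c' = 1" "e * e' = 1" using nz by (auto simp: c'_def e'_def)
    have div: "x / c = x * c'" "x / e = x * e'" "x / (c * e) = x * (c' * e')" for x
      by (auto simp: c'_def e'_def)
    show ?thesis unfolding div using ce by algebra
  qed
  have combine: "A * (S1 + A' * Q) - B * (S2 + B' * Q) = g2 * Q"
    if "A * S1 - B * S2 = g1 * Q" "A * A' - B * B' = g2 - g1" for A B A' B' S1 S2 g1 g2 :: 'a
    using that by algebra
  show ?case
    unfolding sum.atMost_Suc num_def[symmetric] dn_def[symmetric] v_def[symmetric]
      w_def[symmetric] g2 t1 t2
    by (rule combine[OF _ key])
       (use Suc.IH in \<open>simp only: num_def[symmetric] dn_def[symmetric] v_def[symmetric]
          w_def[symmetric] g1\<close>)
qed

text \<open>Induction on \<open>N\<close>: at \<open>y = p ^ N\<close> the telescoped identity is a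
  first-order recurrence in \<open>N\<close>, and its ratio is the ratio of consecutive product
  sides.\<close>

lemma sixphifive_sum:
  fixes a c e p :: "'a::field"
  assumes nz: "p \<noteq> 0" "c \<noteq> 0" "e \<noteq> 0"
    and den: "\<And>k. p ^ Suc k \<noteq> 1" "\<And>k. a * p ^ Suc k \<noteq> c" "\<And>k. a * p ^ Suc k \<noteq> e"
      "\<And>k. a * p ^ Suc k \<noteq> 1"
  shows "(\<Sum>k\<le>N. sixphifive_term p a c e (p ^ N) k)
       = (1 - a) * (q_pochhammer (a * p) p N * q_pochhammer (a * p / (c * e)) p N)
         / (q_pochhammer (a * p / c) p N * q_pochhammer (a * p / e) p N)"
proof (induction N)
  case 0
  then show ?case by (simp add: sixphifive_term_def)
next
  case (Suc N)
  let ?y = "p ^ N"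
  have nzc: "q_pochhammer (a * p / c) p k \<noteq> 0" for k
    using nz den(2) by (auto simp: q_pochhammer_def divide_simps mult.assoc)
  have nze: "q_pochhammer (a * p / e) p k \<noteq> 0" for k
    using nz den(3) by (auto simp: q_pochhammer_def divide_simps mult.assoc)
  have nzp: "q_pochhammer p p k \<noteq> 0" for k
    using den(1) by (auto simp: q_pochhammer_def)
  have nzy: "q_pochhammer (a * p * ?y) p k \<noteq> 0" for k
    using den(4)[of "N + i" for i] by (auto simp: q_pochhammer_def power_add mult.assoc)
  \<comment> \<open>For \<open>y = p ^ N\<close> any product over \<open>i < Suc N\<close> contains
    the zero factor \<open>i = N\<close>. This removes the last term of the sum for
    \<open>y\<close>, and the certificate at \<open>K = Suc N\<close>.\<close>
  have "sixphifive_term p a c e ?y (Suc N) = 0"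
    by (simp add: sixphifive_term_def)
  moreover have "(\<Prod>i<Suc N. ?y - p ^ i) = 0" by simp
  ultimately have eq: "(1 - a * p * ?y / c) * (1 - a * p * ?y / e)
        * (\<Sum>k\<le>Suc N. sixphifive_term p a c e (p ^ Suc N) k)
      = (1 - a * p * ?y) * (1 - a * p * ?y / (c * e)) * (\<Sum>k\<le>N. sixphifive_term p a c e ?y k)"
    using sixphifive_telescope[OF nz nzp nzc nze nzy, of "Suc N"] by simp
  have *: "1 - a * p * ?y / c \<noteq> 0" "1 - a * p * ?y / e \<noteq> 0"
    using nzc[of "Suc N"] nze[of "Suc N"] by (auto simp: q_pochhammer_Suc)
  have "(\<Sum>k\<le>Suc N. sixphifive_term p a c e (p ^ Suc N) k)
      = (1 - a * p * ?y) * (1 - a * p * ?y / (c * e)) * (\<Sum>k\<le>N. sixphifive_term p a c e ?y k)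
        / ((1 - a * p * ?y / c) * (1 - a * p * ?y / e))"
    using eq * by (metis (no_types, lifting) mult_eq_0_iff nonzero_mult_div_cancel_left)
  also have "\<dots> = (1 - a) * (q_pochhammer (a * p) p (Suc N) * q_pochhammer (a * p / (c * e)) p (Suc N))
         / (q_pochhammer (a * p / c) p (Suc N) * q_pochhammer (a * p / e) p (Suc N))"
    unfolding Suc.IH q_pochhammer_Suc by (simp add: mult_ac)
  finally show ?case .
qed

section \<open>Congruences in a localization\<close>

text \<open>The localization of the ring at the denominators prime to \<open>P\<close>. For
  \<open>P\<close> the polynomial Phi_m it contains all integer powers of q, and the inverse of 1 -
  q^i whenever m does not divide i.\<close>

definition local_ring :: "'a::{ring_gcd,idom_divide,semiring_gcd_mult_normalize} \<Rightarrow> 'a fract set" where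
  "local_ring P = {to_fract u / to_fract v | u v. v \<noteq> 0 \<and> coprime v P}"

lemma local_ringI: "v \<noteq> 0 \<Longrightarrow> coprime v P \<Longrightarrow> to_fract u / to_fract v \<in> local_ring P"
  unfolding local_ring_def by blast

lemma local_ringE:
  assumes "x \<in> local_ring P"
  obtains u v where "v \<noteq> 0" "coprime v P" "x = to_fract u / to_fract v"
  using assms unfolding local_ring_def by blast

lemma local_ring_to_fract [simp]: "to_fract u \<in> local_ring P"
  using local_ringI[of 1 P u] by simp

lemma local_ring_0 [simp]: "0 \<in> local_ring P" and local_ring_1 [simp]: "1 \<in> local_ring P"
  using local_ring_to_fract[of 0 P] local_ring_to_fract[of 1 P] by simp_all

lemma local_ring_inverse: "v \<noteq> 0 \<Longrightarrow> coprime v P \<Longrightarrow> inverse (to_fract v) \<in> local_ring P"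
  using local_ringI[of v P 1] by (simp add: divide_inverse)

lemma local_ring_add: "x \<in> local_ring P \<Longrightarrow> y \<in> local_ring P \<Longrightarrow> x + y \<in> local_ring P"
proof (elim local_ringE)
  fix u v u' v' :: 'a
  assume *: "v \<noteq> 0" "coprime v P" "x = to_fract u / to_fract v"
    "v' \<noteq> 0" "coprime v' P" "y = to_fract u' / to_fract v'"
  then have "x + y = to_fract (u * v' + u' * v) / to_fract (v * v')"
    by (simp add: field_simps)
  with * show "x + y \<in> local_ring P"
    by (simp only:) (rule local_ringI, auto)
qed

lemma local_ring_mult: "x \<in> local_ring P \<Longrightarrow> y \<in> local_ring P \<Longrightarrow> x * y \<in> local_ring P"
proof (elim local_ringE)
  fix u v u' v' :: 'a
  assume *: "v \<noteq> 0" "coprime v P" "x = to_fract u / to_fract v"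
    "v' \<noteq> 0" "coprime v' P" "y = to_fract u' / to_fract v'"
  then have "x * y = to_fract (u * u') / to_fract (v * v')"
    by simp
  with * show "x * y \<in> local_ring P"
    by (simp only:) (rule local_ringI, auto)
qed

lemma local_ring_uminus: "x \<in> local_ring P \<Longrightarrow> - x \<in> local_ring P"
  using local_ring_mult[OF local_ring_to_fract[of "- 1" P], of x] by simp

lemma local_ring_diff: "x \<in> local_ring P \<Longrightarrow> y \<in> local_ring P \<Longrightarrow> x - y \<in> local_ring P"
  using local_ring_add[of x P "- y"] local_ring_uminus[of y P] by simp

lemma local_ring_prod: "(\<And>i. i \<in> I \<Longrightarrow> f i \<in> local_ring P) \<Longrightarrow> prod f I \<in> local_ring P"
  by (induction I rule: infinite_finite_induct) (auto intro: local_ring_mult)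

lemma local_ring_power: "x \<in> local_ring P \<Longrightarrow> x ^ k \<in> local_ring P"
  by (induction k) (auto intro: local_ring_mult)

text \<open>\<open>P\<close> governs the admissible denominators and \<open>M\<close> is the
  modulus, so that congruences modulo Phi_m and modulo its square live in the same ring. Membership
  of both sides is built in, which makes products of congruences free of side conditions.\<close>

definition local_cong ::
  "'a::{ring_gcd,idom_divide,semiring_gcd_mult_normalize} \<Rightarrow> 'a \<Rightarrow> 'a fract \<Rightarrow> 'a fract \<Rightarrow> bool" where
  "local_cong P M x y \<longleftrightarrow>
     x \<in> local_ring P \<and> y \<in> local_ring P \<and> (\<exists>z \<in> local_ring P. x - y = to_fract M * z)"

lemma local_congI:
  "x \<in> local_ring P \<Longrightarrow> y \<in> local_ring P \<Longrightarrow> z \<in> local_ring P \<Longrightarrow> x - y = to_fract M * z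
    \<Longrightarrow> local_cong P M x y"
  unfolding local_cong_def by blast

lemma local_congD: "local_cong P M x y \<Longrightarrow> x \<in> local_ring P" "local_cong P M x y \<Longrightarrow> y \<in> local_ring P"
  by (auto simp: local_cong_def)

lemma local_cong_refl: "x \<in> local_ring P \<Longrightarrow> local_cong P M x x"
  by (rule local_congI[of _ _ _ 0]) auto

lemma local_cong_sym:
  assumes "local_cong P M x y"
  shows "local_cong P M y x"
proof -
  obtain z where "z \<in> local_ring P" "x - y = to_fract M * z"
    using assms by (auto simp: local_cong_def)
  then show ?thesis
    using local_congD[OF assms]
    by (intro local_congI[of _ _ _ "- z"]) (auto intro: local_ring_uminus simp: algebra_simps)
qed

lemma local_cong_trans [trans]:
  assumes "local_cong P M x y" "local_cong P M y z"
  shows "local_cong P M x z"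
proof -
  obtain s t where "s \<in> local_ring P" "x - y = to_fract M * s" "t \<in> local_ring P" "y - z = to_fract M * t"
    using assms by (auto simp: local_cong_def)
  then show ?thesis
    using local_congD[OF assms(1)] local_congD[OF assms(2)]
    by (intro local_congI[of _ _ _ "s + t"]) (auto intro: local_ring_add simp: algebra_simps)
qed

lemma local_cong_add:
  assumes "local_cong P M x y" "local_cong P M x' y'"
  shows "local_cong P M (x + x') (y + y')"
proof -
  obtain s t where st: "s \<in> local_ring P" "x - y = to_fract M * s" "t \<in> local_ring P" "x' - y' = to_fract M * t"
    using assms by (auto simp: local_cong_def)
  then have "x + x' - (y + y') = to_fract M * (s + t)"
    by algebra
  with st show ?thesis
    using local_congD[OF assms(1)] local_congD[OF assms(2)]
    by (intro local_congI[of _ _ _ "s + t"]) (auto intro: local_ring_add)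
qed

lemma local_cong_mult:
  assumes "local_cong P M x y" "local_cong P M x' y'"
  shows "local_cong P M (x * x') (y * y')"
proof -
  obtain s t where st: "s \<in> local_ring P" "x - y = to_fract M * s" "t \<in> local_ring P" "x' - y' = to_fract M * t"
    using assms by (auto simp: local_cong_def)
  then have "x * x' - y * y' = to_fract M * (s * x' + y * t)"
    by algebra
  with st show ?thesis
    using local_congD[OF assms(1)] local_congD[OF assms(2)]
    by (intro local_congI[of _ _ _ "s * x' + y * t"]) (auto intro: local_ring_add local_ring_mult)
qed

lemma local_cong_sum:
  "(\<And>i. i \<in> I \<Longrightarrow> local_cong P M (f i) (g i)) \<Longrightarrow> local_cong P M (sum f I) (sum g I)"
  by (induction I rule: infinite_finite_induct) (auto intro: local_cong_add local_cong_refl)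

lemma local_cong_prod:
  "(\<And>i. i \<in> I \<Longrightarrow> local_cong P M (f i) (g i)) \<Longrightarrow> local_cong P M (prod f I) (prod g I)"
  by (induction I rule: infinite_finite_induct) (auto intro: local_cong_mult local_cong_refl)

lemma local_cong_power: "local_cong P M x y \<Longrightarrow> local_cong P M (x ^ k) (y ^ k)"
  by (induction k) (auto intro: local_cong_mult local_cong_refl)

lemma local_cong_inverse:
  assumes "local_cong P M x y" "inverse x \<in> local_ring P" "inverse y \<in> local_ring P" "x \<noteq> 0" "y \<noteq> 0"
  shows "local_cong P M (inverse x) (inverse y)"
proof -
  obtain s where s: "s \<in> local_ring P" "x - y = to_fract M * s"
    using assms by (auto simp: local_cong_def)
  have "inverse x - inverse y = to_fract M * (- s * inverse x * inverse y)"
    using assms(4,5) s(2) by (simp add: field_simps)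
  with s assms(2,3) show ?thesis
    by (intro local_congI[of _ _ _ "- s * inverse x * inverse y"])
       (auto intro: local_ring_mult local_ring_uminus)
qed

text \<open>Two separate factors, each divisible by Phi_m, give the square of Phi_m through this
  rule.\<close>

lemma local_cong_mult_0:
  assumes "local_cong P M x 0" "local_cong P N y 0"
  shows "local_cong P (M * N) (x * y) 0"
proof -
  obtain s t where st: "s \<in> local_ring P" "x = to_fract M * s" "t \<in> local_ring P" "y = to_fract N * t"
    using assms by (auto simp: local_cong_def)
  then have "x * y = to_fract (M * N) * (s * t)" by simp
  with st show ?thesis
    using local_congD[OF assms(1)] local_congD[OF assms(2)]
    by (intro local_congI[of _ _ _ "s * t"]) (auto intro: local_ring_mult)
qed

lemma local_cong_0_mult_right:
  "local_cong P M x 0 \<Longrightarrow> y \<in> local_ring P \<Longrightarrow> local_cong P M (x * y) 0"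
  using local_cong_mult[of P M x 0 y y] by (simp add: local_cong_refl)

text \<open>This leads back from the localization to \<open>ratfun_cong\<close>. Clearing
  denominators gives \<open>a * v = P ^ k * u * b\<close> with \<open>v\<close> prime to
  \<open>P\<close>, so the power of \<open>P\<close> must divide the reduced numerator
  \<open>a\<close>.\<close>

lemma dvd_fst_quot_of_fract:
  assumes "local_cong P (P ^ k) x 0"
  shows "P ^ k dvd fst (quot_of_fract x)"
proof -
  obtain z where z: "z \<in> local_ring P" "x = to_fract (P ^ k) * z"
    using assms by (auto simp: local_cong_def)
  then obtain u v where uv: "v \<noteq> 0" "coprime v P" "z = to_fract u / to_fract v"
    by (elim local_ringE)
  define a b where "a = fst (quot_of_fract x)" and "b = snd (quot_of_fract x)"
  have b: "b \<noteq> 0" by (simp add: b_def)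
  have "x = to_fract a / to_fract b"
    unfolding a_def b_def Fract_conv_to_fract[symmetric] by simp
  with z uv b have "to_fract (a * v) = to_fract (P ^ k * u * b)"
    by (simp add: field_simps)
  then have "a * v = P ^ k * u * b" by (simp only: to_fract_eq_iff)
  then have "P ^ k dvd a * v" by simp
  moreover have "coprime (P ^ k) v" using uv(2) by (simp add: coprime_commute)
  ultimately show ?thesis
    unfolding a_def by (simp add: coprime_dvd_mult_left_iff)
qed

section \<open>Cyclotomic polynomials\<close>

lemma lead_coeff_cyclotomic:
  assumes "n > 0"
  shows "lead_coeff (cyclotomic n) = 1"
proof -
  have "lead_coeff (map_poly (of_int :: int \<Rightarrow> complex) (cyclotomic n)) = 1"
    unfolding of_int_cyclotomic[OF assms] by (simp add: lead_coeff_prod)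
  then show ?thesis by (simp add: coeff_map_poly degree_map_poly)
qed

lemma poly_of_int_cyclotomic_eq_0_iff:
  assumes "n > 0"
  shows "poly (map_poly of_int (cyclotomic n)) z = 0 \<longleftrightarrow> z \<in> primitive_roots_of_unity n"
  unfolding of_int_cyclotomic[OF assms] poly_prod
  using finite_primitive_roots_of_unity[OF assms] by auto

text \<open>A common divisor of positive degree would have a complex root, at which both polynomials
  vanish. A constant common divisor is a unit because the cyclotomic polynomial is monic.\<close>

lemma coprime_cyclotomic:
  assumes n: "n > 0"
    and nz: "\<And>z. z \<in> primitive_roots_of_unity n \<Longrightarrow> poly (map_poly of_int f) z \<noteq> 0"
  shows "coprime f (cyclotomic n)"
proof (rule coprimeI)
  fix g assume g: "g dvd f" "g dvd cyclotomic n"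
  then obtain h k where h: "cyclotomic n = g * h" and k: "f = g * k" by (auto elim!: dvdE)
  have lc: "lead_coeff g * lead_coeff h = 1"
    using lead_coeff_cyclotomic[OF n] by (simp add: h lead_coeff_mult)
  have deg: "degree (map_poly (of_int :: int \<Rightarrow> complex) g) = degree g"
    by (rule degree_map_poly) simp
  have "degree g = 0"
  proof (rule ccontr)
    assume "degree g \<noteq> 0"
    then obtain z where z: "poly (map_poly of_int g) (z::complex) = 0"
      using alg_closed_imp_poly_has_root[of "map_poly (of_int :: int \<Rightarrow> complex) g"] deg by auto
    then have "poly (map_poly of_int (cyclotomic n)) z = 0" "poly (map_poly of_int f) z = 0"
      unfolding h k map_poly_of_int_mult by simp_all
    with nz n show False by (simp add: poly_of_int_cyclotomic_eq_0_iff)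
  qed
  then obtain c where "g = [:c:]" by (rule degree_eq_zeroE)
  moreover from this lc have "c * lead_coeff h = 1" by simp
  then have "c dvd 1" by (metis dvd_triv_left)
  ultimately show "is_unit g" by (simp only: is_unit_const_poly_iff)
qed

lemma map_poly_of_int_monom_minus_1:
  "map_poly (of_int :: int \<Rightarrow> complex) (monom 1 n - 1) = monom 1 n - 1"
  by (rule poly_eqI) (simp add: coeff_map_poly)

lemma prod_cyclotomic:
  assumes "n > 0"
  shows "(\<Prod>d | d dvd n. cyclotomic d) = monom 1 n - 1"
proof -
  have "map_poly (of_int :: int \<Rightarrow> complex) (\<Prod>d | d dvd n. cyclotomic d) =
        (\<Prod>d | d dvd n. \<Prod>z\<in>primitive_roots_of_unity d. [:- z, 1:])"
    unfolding map_poly_of_int_prod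
    by (rule prod.cong) (use assms in \<open>auto intro!: of_int_cyclotomic intro: dvd_pos_nat\<close>)
  also have "\<dots> = map_poly of_int (monom 1 n - 1)"
    using assms by (simp add: prod_primitive_roots_of_unity map_poly_of_int_monom_minus_1)
  finally show ?thesis by (simp only: map_poly_of_int_inj)
qed

lemma cyclotomic_1: "cyclotomic 1 = poly_q - 1"
  using prod_cyclotomic[of 1] by (simp add: poly_q_def monom_altdef)

lemma monom_eq_poly_q_power: "monom 1 n = poly_q ^ n"
  by (simp add: poly_q_def monom_altdef)

text \<open>Cancel Phi_1 = q - 1 from the factorization of q^n - 1.\<close>

lemma q_int_poly_q:
  assumes "n > 0"
  shows "q_int poly_q n = (\<Prod>m | m dvd n \<and> m \<noteq> 1. cyclotomic m)"
proof -
  have "(poly_q - 1) * q_int poly_q n = poly_q ^ n - 1"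
    unfolding q_int_def by (rule power_diff_1_eq[symmetric])
  also have "\<dots> = (\<Prod>d | d dvd n. cyclotomic d)"
    using assms by (simp add: prod_cyclotomic monom_eq_poly_q_power)
  also have "\<dots> = cyclotomic 1 * (\<Prod>d \<in> {d. d dvd n} - {1}. cyclotomic d)"
    using assms by (intro prod.remove) auto
  also have "{d. d dvd n} - {1} = {m. m dvd n \<and> m \<noteq> 1}" by auto
  finally have "(poly_q - 1) * q_int poly_q n = (poly_q - 1) * (\<Prod>m | m dvd n \<and> m \<noteq> 1. cyclotomic m)"
    by (simp only: cyclotomic_1)
  moreover have "poly_q - 1 \<noteq> 0" by (simp add: poly_q_def one_pCons)
  ultimately show ?thesis by simp
qed

lemma cyclotomic_dvd:
  assumes "n > 0" "n dvd a"
  shows "cyclotomic n dvd poly_q ^ a - 1"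
proof -
  obtain b where b: "a = n * b" using assms(2) by blast
  have "cyclotomic n dvd (\<Prod>d | d dvd n. cyclotomic d)"
    using assms(1) by (intro dvd_prodI) auto
  also have "\<dots> = poly_q ^ n - 1"
    using assms by (simp add: prod_cyclotomic monom_eq_poly_q_power)
  also have "poly_q ^ n - 1 dvd poly_q ^ a - 1"
    unfolding b power_mult by (subst power_diff_1_eq[of "poly_q ^ n" b]) simp
  finally show ?thesis .
qed

lemma coprime_cyclotomic_cyclotomic:
  assumes "m > 0" "n > 0" "m \<noteq> n"
  shows "coprime (cyclotomic m) (cyclotomic n)"
proof (rule coprime_cyclotomic[OF assms(2)])
  fix z :: complex assume z: "z \<in> primitive_roots_of_unity n"
  have "z \<notin> primitive_roots_of_unity m"
    using z assms by (auto simp: primitive_roots_of_unity_def) (metis nat_neq_iff)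
  then show "poly (map_poly of_int (cyclotomic m)) z \<noteq> 0"
    using assms(1) by (simp add: poly_of_int_cyclotomic_eq_0_iff)
qed

lemma primitive_root_power_eq_1_iff:
  assumes "z \<in> primitive_roots_of_unity n" "n > 0"
  shows "z ^ a = 1 \<longleftrightarrow> n dvd a"
proof
  assume "z ^ a = 1"
  moreover have "z ^ a = z ^ (n * (a div n) + a mod n)" by simp
  then have "z ^ a = z ^ (a mod n)"
    using assms(1) unfolding power_add power_mult by (simp add: primitive_roots_of_unity_def)
  ultimately show "n dvd a"
    using assms by (auto simp: primitive_roots_of_unity_def) (metis mod_less_divisor mod_0_imp_dvd neq0_conv)
qed (use assms in \<open>auto simp: primitive_roots_of_unity_def power_mult\<close>)

lemma poly_of_int_poly_q_power: "poly (map_poly of_int (poly_q ^ a)) (z::complex) = z ^ a"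
  by (simp add: poly_q_def monom_altdef[of 1, symmetric, simplified] map_poly_monom poly_monom)

lemma coprime_poly_q_cyclotomic:
  assumes "n > 0"
  shows "coprime (poly_q ^ a) (cyclotomic n)"
proof (rule coprime_cyclotomic[OF assms])
  fix z :: complex assume z: "z \<in> primitive_roots_of_unity n"
  then have "z \<noteq> 0" using assms by (auto simp: primitive_roots_of_unity_def power_0_left)
  then show "poly (map_poly of_int (poly_q ^ a)) z \<noteq> 0"
    by (simp add: poly_of_int_poly_q_power)
qed

lemma coprime_q_power_minus_1_cyclotomic:
  assumes "n > 0" "\<not> n dvd a"
  shows "coprime (poly_q ^ a - 1) (cyclotomic n)"
proof (rule coprime_cyclotomic[OF assms(1)])
  fix z :: complex assume z: "z \<in> primitive_roots_of_unity n"
  have "map_poly (of_int :: int \<Rightarrow> complex) (poly_q ^ a - 1) = monom 1 a - 1"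
    by (simp only: monom_eq_poly_q_power[symmetric] map_poly_of_int_monom_minus_1)
  then show "poly (map_poly of_int (poly_q ^ a - 1)) z \<noteq> 0"
    using primitive_root_power_eq_1_iff[OF z assms(1)] assms(2) by (simp add: poly_monom)
qed

text \<open>At a primitive n-th root of unity every summand of the q-integer in base q^n equals 1,
  so its value there is the nonzero number \<open>b\<close>.\<close>

lemma coprime_q_int_power_cyclotomic:
  assumes "n > 0" "b > 0"
  shows "coprime (q_int (poly_q ^ n) b) (cyclotomic n)"
proof (rule coprime_cyclotomic[OF assms(1)])
  fix z :: complex assume z: "z \<in> primitive_roots_of_unity n"
  have sum: "map_poly (of_int :: int \<Rightarrow> complex) (sum f A) = (\<Sum>x\<in>A. map_poly of_int (f x))"
    for f :: "nat \<Rightarrow> int poly" and A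
    by (induction A rule: infinite_finite_induct) (simp_all add: map_poly_of_int_add)
  have "poly (map_poly of_int (q_int (poly_q ^ n) b)) z = of_nat b"
    unfolding q_int_def sum poly_sum power_mult[symmetric] poly_of_int_poly_q_power
    using z by (simp add: power_mult primitive_roots_of_unity_def)
  then show "poly (map_poly of_int (q_int (poly_q ^ n) b)) z \<noteq> 0"
    using assms(2) by simp
qed

section \<open>Powers of $q$ modulo a cyclotomic polynomial\<close>

lemma local_cong_dvd_modulus:
  assumes "local_cong P M x y" "N dvd M"
  shows "local_cong P N x y"
proof -
  obtain z where z: "z \<in> local_ring P" "x - y = to_fract M * z"
    using assms by (auto simp: local_cong_def)
  obtain K where "M = N * K" using assms(2) by blast
  with z show ?thesis
    using local_congD[OF assms(1)]
    by (intro local_congI[of _ _ _ "to_fract K * z"]) (auto intro: local_ring_mult)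
qed

lemma ratfun_q_power: "ratfun_q ^ a = to_fract (poly_q ^ a)"
  by (induction a) (simp_all add: ratfun_q_def to_fract_def[symmetric])

lemma ratfun_q_nz [simp]: "ratfun_q \<noteq> 0"
proof -
  have "to_fract poly_q \<noteq> 0" by (simp add: poly_q_def)
  then show ?thesis by (simp add: ratfun_q_def to_fract_def)
qed

lemma poly_q_power_eq_1_iff: "poly_q ^ a = 1 \<longleftrightarrow> a = 0"
proof
  assume "poly_q ^ a = 1"
  then have "degree (monom (1::int) a) = 0" by (simp add: monom_eq_poly_q_power)
  then show "a = 0" by (simp add: degree_monom_eq)
qed simp

lemma ratfun_q_power_eq_iff: "ratfun_q ^ a = ratfun_q ^ b \<longleftrightarrow> a = b"
proof -
  have "a = b" if eq: "ratfun_q ^ a = ratfun_q ^ b" and le: "a \<le> b" for a b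
  proof -
    obtain k where k: "b = a + k" using le le_Suc_ex by blast
    have "ratfun_q ^ k = 1" using eq by (simp add: k power_add)
    then have "to_fract (poly_q ^ k) = to_fract 1" by (simp add: ratfun_q_power)
    then show ?thesis unfolding to_fract_eq_iff by (simp add: poly_q_power_eq_1_iff k)
  qed
  from this[of a b] this[of b a] show ?thesis by (metis nle_le)
qed

lemma ratfun_q_power_eq_1_iff: "ratfun_q ^ a = 1 \<longleftrightarrow> a = 0"
  using ratfun_q_power_eq_iff[of a 0] by simp

lemma local_ring_ratfun_q_power [simp]: "ratfun_q ^ a \<in> local_ring P"
  by (simp add: ratfun_q_power)

lemma local_ring_ratfun_q_powi:
  assumes "m > 0"
  shows "ratfun_q powi i \<in> local_ring (cyclotomic m)"
proof (cases i rule: int_cases2)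
  case (nonpos a)
  have "inverse (to_fract (poly_q ^ a)) \<in> local_ring (cyclotomic m)"
    by (rule local_ring_inverse)
       (use coprime_poly_q_cyclotomic[OF assms] in \<open>auto simp: poly_q_def\<close>)
  then show ?thesis by (simp add: nonpos power_int_minus ratfun_q_power)
qed simp

lemma ratfun_q_power_minus_1_cong:
  assumes "m > 0" "m dvd a"
  shows "local_cong (cyclotomic m) (cyclotomic m) (ratfun_q ^ a) 1"
proof -
  obtain f where f: "poly_q ^ a - 1 = cyclotomic m * f"
    using cyclotomic_dvd[OF assms] by (elim dvdE)
  have "ratfun_q ^ a - 1 = to_fract (poly_q ^ a - 1)"
    by (simp only: ratfun_q_power to_fract_diff to_fract_1)
  also have "\<dots> = to_fract (cyclotomic m) * to_fract f" by (simp only: f to_fract_mult)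
  finally show ?thesis
    by (rule local_congI[OF local_ring_ratfun_q_power local_ring_1 local_ring_to_fract])
qed

lemma ratfun_q_powi_minus_1_cong:
  assumes "m > 0" "int m dvd i"
  shows "local_cong (cyclotomic m) (cyclotomic m) (ratfun_q powi i) 1"
proof (cases i rule: int_cases2)
  case (nonneg a)
  then have "m dvd a" using assms(2) by simp
  then show ?thesis
    unfolding nonneg power_int_of_nat by (rule ratfun_q_power_minus_1_cong[OF assms(1)])
next
  case (nonpos a)
  then have "m dvd a" using assms(2) by simp
  then have "local_cong (cyclotomic m) (cyclotomic m) (ratfun_q powi i * ratfun_q ^ a) (ratfun_q powi i * 1)"
    by (intro local_cong_mult[OF local_cong_refl ratfun_q_power_minus_1_cong] local_ring_ratfun_q_powi assms(1))
  moreover have "ratfun_q powi i * ratfun_q ^ a = 1"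
    unfolding nonpos power_int_minus power_int_of_nat
    by (rule left_inverse) (rule power_not_zero[OF ratfun_q_nz])
  ultimately have "local_cong (cyclotomic m) (cyclotomic m) 1 (ratfun_q powi i)"
    by (simp only: mult_1_right)
  then show ?thesis by (rule local_cong_sym)
qed

lemma ratfun_q_powi_cong:
  assumes "m > 0" "[i = j] (mod int m)"
  shows "local_cong (cyclotomic m) (cyclotomic m) (ratfun_q powi i) (ratfun_q powi j)"
proof -
  have "local_cong (cyclotomic m) (cyclotomic m) (ratfun_q powi (i - j) * ratfun_q powi j) (1 * ratfun_q powi j)"
    using assms
    by (intro local_cong_mult[OF ratfun_q_powi_minus_1_cong local_cong_refl] local_ring_ratfun_q_powi)
       (auto simp: cong_iff_dvd_diff)
  moreover have "ratfun_q powi (i - j) * ratfun_q powi j = ratfun_q powi i"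
    using power_int_add[of ratfun_q "i - j" j] by simp
  ultimately show ?thesis by simp
qed

lemma ratfun_q_power_cong:
  assumes "m > 0" "[a = b] (mod m)"
  shows "local_cong (cyclotomic m) (cyclotomic m) (ratfun_q ^ a) (ratfun_q ^ b)"
  using ratfun_q_powi_cong[of m "int a" "int b"] assms by (simp add: cong_int_iff)

text \<open>The numerator of 1 - q^i is prime to Phi_m. Negative exponents reduce to positive ones
  by 1 - q^(-a) = (q^a - 1) q^(-a), where q^a is itself a unit.\<close>

lemma one_minus_ratfun_q_powi_unit:
  assumes "m > 0" "\<not> int m dvd i"
  shows "1 - ratfun_q powi i \<noteq> 0" "inverse (1 - ratfun_q powi i) \<in> local_ring (cyclotomic m)"
proof -
  have nat: "ratfun_q ^ a - 1 \<noteq> 0 \<and> inverse (ratfun_q ^ a - 1) \<in> local_ring (cyclotomic m)"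
    if "\<not> m dvd a" for a
  proof
    have "a \<noteq> 0" using that by (intro notI) simp
    then show "ratfun_q ^ a - 1 \<noteq> 0" by (simp add: ratfun_q_power_eq_1_iff)
    have "ratfun_q ^ a - 1 = to_fract (poly_q ^ a - 1)" by (simp add: ratfun_q_power)
    moreover have "poly_q ^ a - 1 \<noteq> 0" using \<open>a \<noteq> 0\<close> by (simp add: poly_q_power_eq_1_iff)
    ultimately show "inverse (ratfun_q ^ a - 1) \<in> local_ring (cyclotomic m)"
      using coprime_q_power_minus_1_cyclotomic[OF assms(1) that]
      by (simp only:) (rule local_ring_inverse)
  qed
  have "1 - ratfun_q powi i \<noteq> 0 \<and> inverse (1 - ratfun_q powi i) \<in> local_ring (cyclotomic m)"
  proof (cases i rule: int_cases2)
    case (nonneg a)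
    with nat[of a] assms(2) have "ratfun_q ^ a \<noteq> 1"
      and L: "inverse (ratfun_q ^ a - 1) \<in> local_ring (cyclotomic m)" by auto
    moreover have "inverse (1 - ratfun_q ^ a) = - inverse (ratfun_q ^ a - 1)"
      by (metis inverse_minus_eq minus_diff_eq)
    ultimately show ?thesis by (simp add: nonneg local_ring_uminus)
  next
    case (nonpos a)
    with nat[of a] assms(2) have "ratfun_q ^ a \<noteq> 1"
      and L: "inverse (ratfun_q ^ a - 1) \<in> local_ring (cyclotomic m)" by auto
    moreover have "1 - ratfun_q powi i = (ratfun_q ^ a - 1) * inverse (ratfun_q ^ a)"
      by (simp add: nonpos power_int_minus field_simps)
    moreover have "inverse \<dots> = inverse (ratfun_q ^ a - 1) * ratfun_q ^ a" by simp
    ultimately show ?thesis by (simp add: local_ring_mult)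
  qed
  then show "1 - ratfun_q powi i \<noteq> 0" "inverse (1 - ratfun_q powi i) \<in> local_ring (cyclotomic m)"
    by auto
qed

section \<open>q-integers and q-Pochhammer symbols in the localization\<close>

lemma q_int_ratfun_q_eq: "q_int ratfun_q k = (1 - ratfun_q ^ k) * inverse (1 - ratfun_q)"
proof -
  have nz: "1 - ratfun_q \<noteq> 0" using ratfun_q_power_eq_1_iff[of 1] by simp
  have "1 - ratfun_q ^ k = (1 - ratfun_q) * q_int ratfun_q k"
    unfolding q_int_def by (rule one_diff_power_eq)
  also have "\<dots> * inverse (1 - ratfun_q) = q_int ratfun_q k"
    using nz by (simp only: mult.commute[of "1 - ratfun_q"] mult.assoc right_inverse left_inverse mult_1_right not_False_eq_True)
  finally show ?thesis by (rule sym)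
qed

text \<open>Here Phi_m divides the denominator. The common factor 1 - q^m cancels, however, and
  leaves a quotient of q-integers in base q^m whose denominator is prime to Phi_m.\<close>

lemma local_ring_q_power_quotient:
  assumes "m > 0" "b > 0"
  shows "(1 - ratfun_q ^ (m * a)) * inverse (1 - ratfun_q ^ (m * b)) \<in> local_ring (cyclotomic m)"
proof -
  define x where "x = ratfun_q ^ m"
  have x: "x = to_fract (poly_q ^ m)" by (simp add: x_def ratfun_q_power)
  have q_int: "q_int x k = to_fract (q_int (poly_q ^ m) k)" for k
  proof -
    have "x ^ i = to_fract ((poly_q ^ m) ^ i)" for i
      unfolding x_def power_mult[symmetric] by (rule ratfun_q_power)
    then show ?thesis unfolding q_int_def to_fract_sum by (rule sum.cong[OF refl])
  qed
  have x1: "1 - x \<noteq> 0" using assms by (simp add: x_def ratfun_q_power_eq_1_iff)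
  have e: "1 - ratfun_q ^ (m * k) = (1 - x) * q_int x k" for k
    unfolding q_int_def x_def power_mult by (rule one_diff_power_eq)
  have nz: "q_int (poly_q ^ m) b \<noteq> 0"
  proof
    assume "q_int (poly_q ^ m) b = 0"
    then have "ratfun_q ^ (m * b) = 1" using e[of b] by (simp add: q_int)
    then show False using assms by (simp add: ratfun_q_power_eq_1_iff)
  qed
  have "(1 - ratfun_q ^ (m * a)) * inverse (1 - ratfun_q ^ (m * b))
     = to_fract (q_int (poly_q ^ m) a) / to_fract (q_int (poly_q ^ m) b)"
    unfolding e inverse_mult_distrib q_int divide_inverse using x1 by simp
  also have "\<dots> \<in> local_ring (cyclotomic m)"
    by (intro local_ringI nz coprime_q_int_power_cyclotomic assms)
  finally show ?thesis .
qed

text \<open>Integer exponents cover symbols such as those at q/X and p/X. Whether a factor is a unit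
  or vanishes modulo Phi_m is then read off from divisibility of its exponent by m.\<close>

lemma q_pochhammer_ratfun_q:
  "q_pochhammer (ratfun_q powi i) (ratfun_q ^ d) k = (\<Prod>j<k. 1 - ratfun_q powi (i + int (d * j)))"
  unfolding q_pochhammer_def
proof (rule prod.cong)
  fix j
  have "(ratfun_q ^ d) ^ j = ratfun_q powi int (d * j)"
    unfolding power_mult[symmetric] by (rule power_int_of_nat[symmetric])
  then show "1 - ratfun_q powi i * (ratfun_q ^ d) ^ j = 1 - ratfun_q powi (i + int (d * j))"
    using power_int_add[of ratfun_q i "int (d * j)"] by simp
qed simp

lemma local_ring_q_pochhammer:
  assumes "m > 0"
  shows "q_pochhammer (ratfun_q powi i) (ratfun_q ^ d) k \<in> local_ring (cyclotomic m)"
  unfolding q_pochhammer_ratfun_q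
  by (intro local_ring_prod local_ring_diff local_ring_1 local_ring_ratfun_q_powi assms)

lemma q_pochhammer_unit:
  assumes "m > 0" "\<And>j. j < k \<Longrightarrow> \<not> int m dvd i + int (d * j)"
  shows "q_pochhammer (ratfun_q powi i) (ratfun_q ^ d) k \<noteq> 0"
    "inverse (q_pochhammer (ratfun_q powi i) (ratfun_q ^ d) k) \<in> local_ring (cyclotomic m)"
proof -
  show "q_pochhammer (ratfun_q powi i) (ratfun_q ^ d) k \<noteq> 0"
    unfolding q_pochhammer_ratfun_q prod_zero_iff[OF finite_lessThan]
    using one_minus_ratfun_q_powi_unit(1)[OF assms] by blast
  show "inverse (q_pochhammer (ratfun_q powi i) (ratfun_q ^ d) k) \<in> local_ring (cyclotomic m)"
    unfolding q_pochhammer_ratfun_q prod_inversef[symmetric]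
    by (intro local_ring_prod) (use one_minus_ratfun_q_powi_unit(2)[OF assms] in simp)
qed

lemma q_pochhammer_cong_0:
  assumes "m > 0" "j < k" "int m dvd i + int (d * j)"
  shows "local_cong (cyclotomic m) (cyclotomic m) (q_pochhammer (ratfun_q powi i) (ratfun_q ^ d) k) 0"
proof -
  have "q_pochhammer (ratfun_q powi i) (ratfun_q ^ d) k = (1 - ratfun_q powi (i + int (d * j))) *
        (\<Prod>j\<in>{..<k} - {j}. 1 - ratfun_q powi (i + int (d * j)))"
    unfolding q_pochhammer_ratfun_q using assms(2) by (intro prod.remove) auto
  moreover have "local_cong (cyclotomic m) (cyclotomic m) (1 - ratfun_q powi (i + int (d * j))) 0"
    using local_cong_add[OF local_cong_refl[OF local_ring_1]
        local_cong_mult[OF local_cong_refl[OF local_ring_uminus[OF local_ring_1]]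
          ratfun_q_powi_minus_1_cong[OF assms(1,3)]]] by simp
  ultimately show ?thesis
    by (simp only:) (intro local_cong_0_mult_right local_ring_prod local_ring_diff local_ring_1
        local_ring_ratfun_q_powi assms(1))
qed

lemma local_cong_one_minus: "local_cong P M x y \<Longrightarrow> local_cong P M (1 - x) (1 - y)"
  using local_cong_add[OF local_cong_refl[OF local_ring_1]
        local_cong_mult[OF local_cong_refl[OF local_ring_uminus[OF local_ring_1]]], of P M x y]
  by simp

lemma q_pochhammer_cong:
  assumes "m > 0" "[i = j] (mod int m)"
  shows "local_cong (cyclotomic m) (cyclotomic m) (q_pochhammer (ratfun_q powi i) (ratfun_q ^ d) k)
           (q_pochhammer (ratfun_q powi j) (ratfun_q ^ d) k)"
  unfolding q_pochhammer_ratfun_q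
  using assms by (intro local_cong_prod local_cong_one_minus ratfun_q_powi_cong cong_add) auto

text \<open>The product of the two symbols is symmetric under exchanging X and 1/X, so in each pair
  of factors the error of first order in 1 - X cancels and only a multiple of (1 - X)^2 remains. The
  applications are \<open>b = 1\<close> for the numerator and \<open>b = d\<close> for the
  denominator.\<close>

lemma q_pochhammer_deform_cong:
  fixes b c d k m :: nat
  assumes "m > 0"
  defines "X \<equiv> ratfun_q ^ (c * m)"
  shows "local_cong (cyclotomic m) ((cyclotomic m)\<^sup>2)
     (q_pochhammer (ratfun_q ^ b * X) (ratfun_q ^ d) k * q_pochhammer (ratfun_q ^ b / X) (ratfun_q ^ d) k)
     ((q_pochhammer (ratfun_q ^ b) (ratfun_q ^ d) k)\<^sup>2)"
  unfolding q_pochhammer_def prod.distrib[symmetric] prod_power_distrib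
proof (rule local_cong_prod)
  fix j
  define y where "y = ratfun_q ^ b * (ratfun_q ^ d) ^ j"
  have y: "y \<in> local_ring (cyclotomic m)"
    unfolding y_def power_mult[symmetric] by (intro local_ring_mult local_ring_ratfun_q_power)
  have "local_cong (cyclotomic m) (cyclotomic m) X 1"
    unfolding X_def using ratfun_q_power_cong[OF assms(1), of "c * m" 0] by (simp add: cong_0_iff)
  then have X1: "local_cong (cyclotomic m) (cyclotomic m) (1 - X) 0"
    using local_cong_one_minus by fastforce
  have "local_cong (cyclotomic m) (cyclotomic m * cyclotomic m) ((1 - X) * (1 - X)) 0"
    by (rule local_cong_mult_0[OF X1 X1])
  then obtain z where z: "z \<in> local_ring (cyclotomic m)" "(1 - X) * (1 - X) = to_fract ((cyclotomic m)\<^sup>2) * z"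
    by (auto simp: local_cong_def power2_eq_square)
  have X: "X \<noteq> 0" "X \<in> local_ring (cyclotomic m)" "inverse X \<in> local_ring (cyclotomic m)"
    using local_ring_ratfun_q_powi[OF assms(1), of "- int (c * m)"]
    unfolding X_def by (simp_all only: power_int_minus power_int_of_nat local_ring_ratfun_q_power) simp
  have "(1 - y * X) * (1 - y * inverse X) - (1 - y)\<^sup>2 = to_fract ((cyclotomic m)\<^sup>2) * (- y * inverse X * z)"
  proof -
    have "X * inverse X = 1" using X by simp
    then show ?thesis using z(2) by algebra
  qed
  then have "local_cong (cyclotomic m) ((cyclotomic m)\<^sup>2) ((1 - y * X) * (1 - y * inverse X)) ((1 - y)\<^sup>2)"
    using X y z by (intro local_congI[of _ _ _ "- y * inverse X * z"])
      (simp_all only: local_ring_mult local_ring_uminus local_ring_diff local_ring_power local_ring_1)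
  then show "local_cong (cyclotomic m) ((cyclotomic m)\<^sup>2)
       ((1 - ratfun_q ^ b * X * (ratfun_q ^ d) ^ j) * (1 - ratfun_q ^ b / X * (ratfun_q ^ d) ^ j))
       ((1 - ratfun_q ^ b * (ratfun_q ^ d) ^ j)\<^sup>2)"
    by (simp add: y_def divide_inverse mult_ac)
qed

section \<open>The first $m$ summands\<close>

definition summand :: "nat \<Rightarrow> nat \<Rightarrow> int poly fract" where
  "summand d k = q_int ratfun_q (2 * d * k + 1)
     * (q_pochhammer ratfun_q (ratfun_q ^ d) k ^ 4
        / q_pochhammer (ratfun_q ^ d) (ratfun_q ^ d) k ^ 4)
     * ratfun_q ^ ((d - 2) * k)"

text \<open>The parameters are a = e = q, c = qX and b = p^(-N) = q/X. Hence ap/c = p/X, ap/e = p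
  and ap/b = pX, and the argument of the series is q^(d-2). Division by 1 - q turns the
  very-well-poised factor into the q-integer of the summand.\<close>

lemma sixphifive_term_deformed:
  fixes q :: "'a::field" and d k N :: nat
  assumes nz: "q \<noteq> 0" and d: "d \<ge> 2"
  defines "p \<equiv> q ^ d"
  defines "X \<equiv> q * p ^ N"
  shows "sixphifive_term p q (q\<^sup>2 * p ^ N) q (p ^ N) k * inverse (1 - q)
     = ((1 - q ^ (2 * d * k + 1)) * inverse (1 - q) * (q_pochhammer q p k)\<^sup>2
        * inverse ((q_pochhammer p p k)\<^sup>2) * q ^ ((d - 2) * k))
      * ((q_pochhammer (q * X) p k * q_pochhammer (q / X) p k)
        * inverse (q_pochhammer (p * X) p k * q_pochhammer (p / X) p k))"
proof -
  have pnz: "p \<noteq> 0" using nz by (simp add: p_def)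
  \<comment> \<open>Since q/X = p^(-N), each p^N - p^i is p^N times a factor of the symbol at q/X.
    The extra p^N combines with ap/(ce) to give q^(d-2).\<close>
  have "(q * p / (q\<^sup>2 * p ^ N * q)) ^ k * (\<Prod>i<k. p ^ N - p ^ i)
    = (\<Prod>i<k. (q * p / (q\<^sup>2 * p ^ N * q)) * (p ^ N - p ^ i))"
    by (simp add: prod.distrib)
  also have "\<dots> = (\<Prod>i<k. q ^ (d - 2) * (1 - q / X * p ^ i))"
  proof (rule prod.cong)
    fix i
    have "p = q ^ (d - 2) * q\<^sup>2"
      unfolding p_def power_add[symmetric] using d by (simp only: le_add_diff_inverse2)
    then have "q * p / (q\<^sup>2 * p ^ N * q) = q * (q ^ (d - 2) * q\<^sup>2) / (q\<^sup>2 * p ^ N * q)"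
      by simp
    also have "\<dots> = q ^ (d - 2) / p ^ N" using nz pnz by simp
    finally have "q * p / (q\<^sup>2 * p ^ N * q) = q ^ (d - 2) / p ^ N" .
    moreover have "p ^ N - p ^ i = p ^ N * (1 - q / X * p ^ i)"
      using nz pnz by (simp add: X_def field_simps)
    ultimately show "(q * p / (q\<^sup>2 * p ^ N * q)) * (p ^ N - p ^ i) = q ^ (d - 2) * (1 - q / X * p ^ i)"
      using pnz by simp
  qed simp
  also have "\<dots> = q ^ ((d - 2) * k) * q_pochhammer (q / X) p k"
    by (simp add: prod.distrib q_pochhammer_def power_mult)
  finally have *: "(q * p / (q\<^sup>2 * p ^ N * q)) ^ k * (\<Prod>i<k. p ^ N - p ^ i)
    = q ^ ((d - 2) * k) * q_pochhammer (q / X) p k" .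
  have args: "q * p / (q\<^sup>2 * p ^ N) = p / X" "q * p / q = p" "q * p * p ^ N = p * X"
    "q\<^sup>2 * p ^ N = q * X" "q * p ^ (2 * k) = q ^ (2 * d * k + 1)"
    using nz by (simp_all add: X_def p_def power2_eq_square power_mult[symmetric] mult_ac)
  have "sixphifive_term p q (q\<^sup>2 * p ^ N) q (p ^ N) k = (1 - q * p ^ (2 * k))
    * (q_pochhammer q p k * q_pochhammer (q * X) p k * q_pochhammer q p k)
    * ((q * p / (q\<^sup>2 * p ^ N * q)) ^ k * (\<Prod>i<k. p ^ N - p ^ i))
    / (q_pochhammer p p k * q_pochhammer (p / X) p k * q_pochhammer p p k * q_pochhammer (p * X) p k)"
    unfolding sixphifive_term_def args using nz by (simp add: mult_ac)
  then show ?thesis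
    unfolding * args(5) by (simp add: divide_inverse power2_eq_square mult_ac)
qed

text \<open>This keeps the factors 1 - q^(dj) of the denominators free of Phi_m.\<close>

lemma not_dvd_mult_coprime:
  fixes d j m :: nat
  assumes "coprime m d" "0 < j" "j < m"
  shows "\<not> m dvd d * j"
  using assms by (auto simp: coprime_dvd_mult_right_iff dest: dvd_imp_le)

text \<open>The relation \<open>d * N + 1 = c * m\<close> lets one X play two roles: as q^(cm) it is
  1 modulo Phi_m, and as q p^N it makes the series terminate. Because \<open>k < m\<close>, all
  denominator symbols are units, so the deformation congruence for the denominator can be
  inverted.\<close>

lemma summand_cong_sixphifive_term:
  fixes c d k m N :: nat
  assumes d: "d \<ge> 2" and m: "m > 1" "coprime m d" and N: "d * N + 1 = c * m" and k: "k < m"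
  defines "q \<equiv> ratfun_q" and "p \<equiv> ratfun_q ^ d"
  shows "local_cong (cyclotomic m) ((cyclotomic m)\<^sup>2) (summand d k)
           (sixphifive_term p q (q\<^sup>2 * p ^ N) q (p ^ N) k * inverse (1 - q))"
proof -
  define X where "X = ratfun_q ^ (c * m)"
  have m0: "m > 0" using m by simp
  have X: "X = q * p ^ N"
    unfolding X_def N[symmetric] q_def p_def by (simp add: power_mult)
  \<comment> \<open>\<open>C\<close> holds what stays undeformed: two of the four copies of the
    quotient of symbols, the q-integer and the power of q.\<close>
  define C where "C = (1 - q ^ (2 * d * k + 1)) * inverse (1 - q) * (q_pochhammer q p k)\<^sup>2
    * inverse ((q_pochhammer p p k)\<^sup>2) * q ^ ((d - 2) * k)"
  have p_powi: "p = ratfun_q powi int d" and q_powi: "q = ratfun_q powi int 1"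
    by (simp_all add: p_def q_def)
  have qp: "q_pochhammer p p k = q_pochhammer (ratfun_q powi int d) (ratfun_q ^ d) k"
    "q_pochhammer (p * X) p k = q_pochhammer (ratfun_q powi int (d + c * m)) (ratfun_q ^ d) k"
    "q_pochhammer (p / X) p k = q_pochhammer (ratfun_q powi (int d - int (c * m))) (ratfun_q ^ d) k"
    unfolding p_def X_def power_int_of_nat power_int_diff[OF disjI1[OF ratfun_q_nz]] power_add
    by (rule refl)+
  have ndvd: "\<not> int m dvd int d + int (d * j)" if "j < k" for j
  proof -
    have "\<not> m dvd d * Suc j" using that k m by (intro not_dvd_mult_coprime) auto
    then have "\<not> int m dvd int (d * Suc j)" by (metis int_dvd_int_iff)
    then show ?thesis by (simp add: algebra_simps)
  qed
  \<comment> \<open>Multiplying p by X or 1/X shifts the exponents by a multiple of m, so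
    divisibility by m is as for p itself.\<close>
  have ndvd': "\<not> int m dvd int (d + c * m) + int (d * j)"
    "\<not> int m dvd int d - int (c * m) + int (d * j)" if "j < k" for j
  proof -
    have "int (d + c * m) + int (d * j) = int d + int (d * j) + int c * int m"
      "int d - int (c * m) + int (d * j) = int d + int (d * j) + (- int c) * int m" by simp_all
    then show "\<not> int m dvd int (d + c * m) + int (d * j)"
      "\<not> int m dvd int d - int (c * m) + int (d * j)"
      using ndvd[OF that] by (simp_all only: dvd_add_times_triv_right_iff) simp_all
  qed
  have unit_p: "q_pochhammer p p k \<noteq> 0" "inverse (q_pochhammer p p k) \<in> local_ring (cyclotomic m)"
    unfolding qp by (rule q_pochhammer_unit[OF m0]; erule ndvd)+
  have unit_pX: "q_pochhammer (p * X) p k \<noteq> 0" "inverse (q_pochhammer (p * X) p k) \<in> local_ring (cyclotomic m)"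
    unfolding qp by (rule q_pochhammer_unit[OF m0]; erule ndvd')+
  have unit_pX': "q_pochhammer (p / X) p k \<noteq> 0" "inverse (q_pochhammer (p / X) p k) \<in> local_ring (cyclotomic m)"
    unfolding qp by (rule q_pochhammer_unit[OF m0]; erule ndvd')+
  have nd1: "\<not> int m dvd 1" using m by auto
  have unit_q: "inverse (1 - q) \<in> local_ring (cyclotomic m)"
    using one_minus_ratfun_q_powi_unit(2)[OF m0 nd1] by (simp add: q_def)
  have qL: "q \<in> local_ring (cyclotomic m)"
    using local_ring_ratfun_q_power[of 1 "cyclotomic m"] unfolding q_def power_one_right .
  have C: "C \<in> local_ring (cyclotomic m)"
  proof -
    have "inverse ((q_pochhammer p p k)\<^sup>2) \<in> local_ring (cyclotomic m)"
      unfolding power_inverse[symmetric] by (intro local_ring_power unit_p)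
    moreover have "q_pochhammer q p k \<in> local_ring (cyclotomic m)"
      unfolding q_powi p_def by (rule local_ring_q_pochhammer[OF m0])
    moreover have "1 - q ^ (2 * d * k + 1) \<in> local_ring (cyclotomic m)"
      unfolding q_def by (intro local_ring_diff local_ring_1 local_ring_ratfun_q_power)
    ultimately show ?thesis
      unfolding C_def by (intro local_ring_mult local_ring_power unit_q qL)
  qed
  have arrange: "u * w * (x ^ 4 / y ^ 4) * z
    = u * w * x\<^sup>2 * inverse (y\<^sup>2) * z * (x\<^sup>2 * inverse (y\<^sup>2))" for u w x y z :: "'a::field"
    by (simp add: divide_inverse numeral_eq_Suc mult_ac)
  have eq1: "summand d k = C * ((q_pochhammer q p k)\<^sup>2 * inverse ((q_pochhammer p p k)\<^sup>2))"
    unfolding summand_def C_def q_def p_def q_int_ratfun_q_eq by (rule arrange)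
  have eq2: "sixphifive_term p q (q\<^sup>2 * p ^ N) q (p ^ N) k * inverse (1 - q)
     = C * ((q_pochhammer (q * X) p k * q_pochhammer (q / X) p k)
        * inverse (q_pochhammer (p * X) p k * q_pochhammer (p / X) p k))"
    unfolding C_def X unfolding p_def q_def
    by (rule sixphifive_term_deformed[OF ratfun_q_nz d])
  have def1: "local_cong (cyclotomic m) ((cyclotomic m)\<^sup>2)
     (q_pochhammer (q * X) p k * q_pochhammer (q / X) p k) ((q_pochhammer q p k)\<^sup>2)"
    using q_pochhammer_deform_cong[OF m0, of 1 c d k] by (simp add: q_def p_def X_def)
  have def2: "local_cong (cyclotomic m) ((cyclotomic m)\<^sup>2)
     (q_pochhammer (p * X) p k * q_pochhammer (p / X) p k) ((q_pochhammer p p k)\<^sup>2)"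
    using q_pochhammer_deform_cong[OF m0, of d c d k] by (simp add: q_def p_def X_def)
  have "local_cong (cyclotomic m) ((cyclotomic m)\<^sup>2)
     (inverse (q_pochhammer (p * X) p k * q_pochhammer (p / X) p k)) (inverse ((q_pochhammer p p k)\<^sup>2))"
    using unit_p unit_pX unit_pX'
    by (intro local_cong_inverse def2)
       (auto simp: power_inverse[symmetric] inverse_mult_distrib intro!: local_ring_mult local_ring_power)
  with def1 show ?thesis
    unfolding eq1 eq2
    by (intro local_cong_sym[OF local_cong_mult] local_cong_refl C local_cong_mult)
qed

lemma q_power_quotients:
  fixes q :: "'a::field" and d N :: nat
  assumes "q \<noteq> 0"
  shows "q * q ^ d = q powi (1 + int d)"
    "q * q ^ d / (q\<^sup>2 * (q ^ d) ^ N * q) = q powi (int d - 2 - int (d * N))"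
    "q * q ^ d / (q\<^sup>2 * (q ^ d) ^ N) = q powi (int d - 1 - int (d * N))"
    "q * q ^ d / q = q powi int d"
proof -
  have "(q ^ d) ^ N = q powi int (d * N)"
    unfolding power_mult[symmetric] by (rule power_int_of_nat[symmetric])
  then show "q * q ^ d / (q\<^sup>2 * (q ^ d) ^ N * q) = q powi (int d - 2 - int (d * N))"
    "q * q ^ d / (q\<^sup>2 * (q ^ d) ^ N) = q powi (int d - 1 - int (d * N))"
    using assms by (simp_all add: power_int_diff power2_eq_square del: of_nat_mult)
qed (use assms in \<open>simp_all add: power_int_add\<close>)

text \<open>The first claim rests on the factor 1 - q^(cm) of the symbol at pq alone. The
  \<open>j\<close> of the second claim selects a factor of the other numerator symbol: its exponent
  d - 2 - dN + dj equals d(j + 1) - 1 - cm.\<close>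

lemma truncated_sum_cong:
  fixes c d m N :: nat
  assumes d: "d \<ge> 2" and m: "m > 1" "coprime m d" and N: "d * N + 1 = c * m" "N < m"
  shows "local_cong (cyclotomic m) (cyclotomic m) (\<Sum>k<m. summand d k) 0"
    and "\<lbrakk>j < N; int m dvd int (d * Suc j) - 1\<rbrakk>
      \<Longrightarrow> local_cong (cyclotomic m) ((cyclotomic m)\<^sup>2) (\<Sum>k<m. summand d k) 0"
proof -
  define q p where "q = ratfun_q" and "p = ratfun_q ^ d"
  define t where "t = sixphifive_term p q (q\<^sup>2 * p ^ N) q (p ^ N)"
  have m0: "m > 0" using m by simp
  have nz: "q \<noteq> 0" "p \<noteq> 0" by (auto simp: q_def p_def)
  have q1: "1 - q \<noteq> 0" using ratfun_q_power_eq_1_iff[of 1] by (simp add: q_def)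
  \<comment> \<open>For k > N the term contains the zero factor p^N - p^N, so the range k < m may be
    cut to the terminating series.\<close>
  have "(\<Sum>k<m. t k) = (\<Sum>k\<le>N. t k)"
  proof (rule sum.mono_neutral_right)
    show "\<forall>k \<in> {..<m} - {..N}. t k = 0"
      by (auto simp: t_def sixphifive_term_def prod_zero_iff not_le intro!: bexI[of _ N])
  qed (use N in auto)
  also have "\<dots> = (1 - q) * (q_pochhammer (q * p) p N * q_pochhammer (q * p / (q\<^sup>2 * p ^ N * q)) p N)
         / (q_pochhammer (q * p / (q\<^sup>2 * p ^ N)) p N * q_pochhammer (q * p / q) p N)"
    unfolding t_def
  proof (rule sixphifive_sum)
    \<comment> \<open>The exponents of q are 1 and 2 modulo d, hence different because d >
      1.\<close>
    show "q * p ^ Suc k \<noteq> q\<^sup>2 * p ^ N" for k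
    proof
      assume "q * p ^ Suc k = q\<^sup>2 * p ^ N"
      then have "ratfun_q ^ (1 + d * Suc k) = ratfun_q ^ (2 + d * N)"
        by (simp only: q_def p_def power_add power_mult power_one_right)
      then have "1 + d * Suc k = 2 + d * N" by (simp only: ratfun_q_power_eq_iff)
      then have "d * Suc k = Suc (d * N)" by simp
      then have "d dvd Suc (d * N)" by (metis dvd_triv_left)
      then have "d dvd 1" using dvd_add_right_iff[of d "d * N" 1] by simp
      with d show False by simp
    qed
    show "p ^ Suc k \<noteq> 1" "q * p ^ Suc k \<noteq> q" "q * p ^ Suc k \<noteq> 1" for k
      using d ratfun_q_power_eq_1_iff[of "d * Suc k"] ratfun_q_power_eq_1_iff[of "1 + d * Suc k"]
      by (simp_all only: q_def p_def power_add power_mult power_one_right) auto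
  qed (use nz in auto)
  finally have sum_t: "(\<Sum>k<m. t k * inverse (1 - q))
    = q_pochhammer (q * p) p N * q_pochhammer (q * p / (q\<^sup>2 * p ^ N * q)) p N
      * (inverse (q_pochhammer (q * p / (q\<^sup>2 * p ^ N)) p N) * inverse (q_pochhammer (q * p / q) p N))"
    unfolding sum_distrib_right[symmetric] using q1 by (simp add: divide_inverse)
  have qp: "q_pochhammer (q * p) p N = q_pochhammer (ratfun_q powi (1 + int d)) (ratfun_q ^ d) N"
    "q_pochhammer (q * p / (q\<^sup>2 * p ^ N * q)) p N
       = q_pochhammer (ratfun_q powi (int d - 2 - int (d * N))) (ratfun_q ^ d) N"
    "q_pochhammer (q * p / (q\<^sup>2 * p ^ N)) p N
       = q_pochhammer (ratfun_q powi (int d - 1 - int (d * N))) (ratfun_q ^ d) N"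
    "q_pochhammer (q * p / q) p N = q_pochhammer (ratfun_q powi int d) (ratfun_q ^ d) N"
    unfolding p_def q_def by (simp_all only: q_power_quotients(2-4)[OF ratfun_q_nz])
      (simp only: q_power_quotients(1)[OF ratfun_q_nz])
  have ndvd: "\<not> int m dvd int d + int (d * j)" if "j < N" for j
  proof -
    have "\<not> m dvd d * Suc j" using that N m by (intro not_dvd_mult_coprime) auto
    then have "\<not> int m dvd int (d * Suc j)" by (metis int_dvd_int_iff)
    then show ?thesis by (simp add: algebra_simps)
  qed
  \<comment> \<open>By dN + 1 = cm the starting exponent d - 1 - dN is d - cm, which is d modulo
    m.\<close>
  have ndvd': "\<not> int m dvd int d - 1 - int (d * N) + int (d * j)" if "j < N" for j
  proof -
    have "int (d * N) + 1 = int (c * m)" using N(1) by (metis of_nat_1 of_nat_add)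
    then have "int d - 1 - int (d * N) + int (d * j) = int d + int (d * j) + (- int c) * int m"
      by simp
    then show ?thesis
      using ndvd[OF that] by (simp only: dvd_add_times_triv_right_iff) simp
  qed
  have inv: "inverse (q_pochhammer (q * p / (q\<^sup>2 * p ^ N)) p N) * inverse (q_pochhammer (q * p / q) p N)
      \<in> local_ring (cyclotomic m)"
    unfolding qp by (intro local_ring_mult q_pochhammer_unit(2) m0 ndvd ndvd')
  have "N \<noteq> 0"
  proof
    assume "N = 0"
    with N m show False by (auto dest: sym)
  qed
  \<comment> \<open>The vanishing factor is the last one, \<open>j = N - 1\<close>, with exponent 1
    + dN = cm.\<close>
  have f1: "local_cong (cyclotomic m) (cyclotomic m) (q_pochhammer (q * p) p N) 0"
    unfolding qp
  proof (rule q_pochhammer_cong_0[OF m0])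
    show "N - 1 < N" using \<open>N \<noteq> 0\<close> by simp
    have "1 + int d + int (d * (N - 1)) = int (d * N + 1)"
      using \<open>N \<noteq> 0\<close> by (cases N) (auto simp: algebra_simps)
    also have "int m dvd \<dots>" unfolding N(1) by simp
    finally show "int m dvd 1 + int d + int (d * (N - 1))" .
  qed
  have L2: "q_pochhammer (q * p / (q\<^sup>2 * p ^ N * q)) p N \<in> local_ring (cyclotomic m)"
    unfolding qp by (rule local_ring_q_pochhammer[OF m0])
  have main: "local_cong (cyclotomic m) ((cyclotomic m)\<^sup>2) (\<Sum>k<m. summand d k) (\<Sum>k<m. t k * inverse (1 - q))"
    unfolding t_def q_def p_def
    by (rule local_cong_sum) (rule summand_cong_sixphifive_term[OF d m N(1)], simp)
  show "local_cong (cyclotomic m) (cyclotomic m) (\<Sum>k<m. summand d k) 0"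
    by (rule local_cong_trans[OF local_cong_dvd_modulus[OF main]])
       (unfold sum_t, simp, intro local_cong_0_mult_right f1 L2 inv)
  assume j: "j < N" "int m dvd int (d * Suc j) - 1"
  have f2: "local_cong (cyclotomic m) (cyclotomic m) (q_pochhammer (q * p / (q\<^sup>2 * p ^ N * q)) p N) 0"
    unfolding qp
  proof (rule q_pochhammer_cong_0[OF m0 j(1)])
    have "int (d * N) + 1 = int (c * m)" using N(1) by (metis of_nat_1 of_nat_add)
    then have "int d - 2 - int (d * N) + int (d * j) = (int (d * Suc j) - 1) + (- int c) * int m"
      by (simp add: algebra_simps)
    then show "int m dvd int d - 2 - int (d * N) + int (d * j)"
      using j(2) by (simp only: dvd_add_times_triv_right_iff)
  qed
  show "local_cong (cyclotomic m) ((cyclotomic m)\<^sup>2) (\<Sum>k<m. summand d k) 0"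
    by (rule local_cong_trans[OF main], unfold sum_t power2_eq_square[of "cyclotomic m"])
       (intro local_cong_0_mult_right[OF local_cong_mult_0] f1 f2 inv)
qed

section \<open>Splitting the sum into blocks\<close>

lemma q_pochhammer_add:
  "q_pochhammer x p (i + k) = q_pochhammer x p i * q_pochhammer (x * p ^ i) p k"
  by (induction k) (simp_all add: q_pochhammer_Suc power_add mult_ac)

text \<open>The fourth root of the quotient of symbols. The quotient is treated as one object
  because beyond index m - 1 its denominator is divisible by Phi_m, and only the quotient is known
  to lie in the localization.\<close>

definition summand_root :: "nat \<Rightarrow> nat \<Rightarrow> int poly fract" where
  "summand_root d k = q_pochhammer ratfun_q (ratfun_q ^ d) k
     * inverse (q_pochhammer (ratfun_q ^ d) (ratfun_q ^ d) k)"

lemma summand_eq: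
  "summand d k = q_int ratfun_q (2 * d * k + 1) * summand_root d k ^ 4 * ratfun_q ^ ((d - 2) * k)"
  by (simp only: summand_def summand_root_def power_mult_distrib power_inverse divide_inverse)

lemma summand_root_add:
  "summand_root d (i + k) = summand_root d i
     * (q_pochhammer (ratfun_q powi int (1 + d * i)) (ratfun_q ^ d) k
        * inverse (q_pochhammer (ratfun_q powi int (d + d * i)) (ratfun_q ^ d) k))"
  unfolding summand_root_def q_pochhammer_add[of _ _ i k] power_mult[symmetric] inverse_mult_distrib
    power_int_of_nat power_add power_one_right
  by (simp only: mult_ac)

text \<open>Take N as the residue of -1/d modulo m. It supplies the terminating length for divisors
  m of n and the position of the vanishing numerator factor in every block.\<close>

lemma exists_multiple_minus_1:
  fixes d m :: nat
  assumes "m > 1" "coprime m d"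
  shows "\<exists>N c. N < m \<and> d * N + 1 = c * m"
proof -
  obtain x where x: "[int d * x = 1] (mod int m)"
    using assms(2) cong_solve_coprime_int[of "int d" "int m"] by (auto simp: coprime_commute)
  define N where "N = nat ((- x) mod int m)"
  have N: "int N = (- x) mod int m" using assms by (simp add: N_def)
  have "[int d * int N + 1 = int d * (- x) + int d * x] (mod int m)"
    unfolding N using x by (intro cong_add cong_mult cong_refl cong_sym[OF x]) (simp add: cong_def)
  then have "[int d * int N + 1 = 0] (mod int m)" by simp
  moreover have "int (d * N + 1) = int d * int N + 1" by simp
  ultimately have "int m dvd int (d * N + 1)" by (simp only: cong_0_iff)
  then have "m dvd d * N + 1" by (simp only: int_dvd_int_iff)
  moreover have "int N < int m" unfolding N using assms by simp
  ultimately show ?thesis by (metis dvd_def mult.commute of_nat_less_iff)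
qed

text \<open>In the block, the denominator has one factor whose exponent is a multiple of m, the last
  one, and the other denominator factors are units. The numerator factor at \<open>j = N\<close>
  also has such an exponent, and pairing these two gives an element of the localization.\<close>

lemma q_pochhammer_block_quotient:
  fixes d m u :: nat
  assumes m: "m > 1" "coprime m d" and d: "d > 0"
  shows "q_pochhammer (ratfun_q powi int (1 + d * (u * m))) (ratfun_q ^ d) m
        * inverse (q_pochhammer (ratfun_q powi int (d + d * (u * m))) (ratfun_q ^ d) m)
        \<in> local_ring (cyclotomic m)"
proof -
  have m0: "m > 0" using m by simp
  obtain N c where N: "N < m" "d * N + 1 = c * m"
    using exists_multiple_minus_1[OF m] by blast
  define P where "P = (\<Prod>j\<in>{..<m} - {N}. 1 - ratfun_q powi (int (1 + d * (u * m)) + int (d * j)))"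
  define D where "D = q_pochhammer (ratfun_q powi int (d + d * (u * m))) (ratfun_q ^ d) (m - 1)"
  have "q_pochhammer (ratfun_q powi int (1 + d * (u * m))) (ratfun_q ^ d) m
      = (1 - ratfun_q powi (int (1 + d * (u * m)) + int (d * N))) * P"
    unfolding q_pochhammer_ratfun_q P_def using N(1) by (intro prod.remove) auto
  also have "int (1 + d * (u * m)) + int (d * N) = int (m * (d * u + c))"
  proof -
    have "1 + d * (u * m) + d * N = m * (d * u + c)"
      using N(2) by (simp add: algebra_simps)
    then show ?thesis by (simp only: of_nat_add[symmetric])
  qed
  finally have num: "q_pochhammer (ratfun_q powi int (1 + d * (u * m))) (ratfun_q ^ d) m
      = (1 - ratfun_q ^ (m * (d * u + c))) * P" by (simp only: power_int_of_nat)
  have "q_pochhammer (ratfun_q powi int (d + d * (u * m))) (ratfun_q ^ d) (Suc (m - 1))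
      = D * (1 - ratfun_q ^ (d + d * (u * m)) * (ratfun_q ^ d) ^ (m - 1))"
    unfolding D_def q_pochhammer_Suc power_int_of_nat by (rule refl)
  also have "ratfun_q ^ (d + d * (u * m)) * (ratfun_q ^ d) ^ (m - 1) = ratfun_q ^ (m * (d * (u + 1)))"
  proof -
    have "d + d * (u * m) + d * (m - 1) = m * (d * (u + 1))"
      using m0 by (cases m) (simp_all add: algebra_simps)
    then show ?thesis by (simp only: power_mult[symmetric] power_add[symmetric])
  qed
  finally have den: "q_pochhammer (ratfun_q powi int (d + d * (u * m))) (ratfun_q ^ d) m
      = D * (1 - ratfun_q ^ (m * (d * (u + 1))))"
    unfolding Suc_diff_1[OF m0] .
  have P: "P \<in> local_ring (cyclotomic m)"
    unfolding P_def by (intro local_ring_prod local_ring_diff local_ring_1 local_ring_ratfun_q_powi m0)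
  have D: "inverse D \<in> local_ring (cyclotomic m)"
    unfolding D_def
  proof (rule q_pochhammer_unit(2)[OF m0])
    fix j assume "j < m - 1"
    then have "\<not> m dvd d * Suc j" using m by (intro not_dvd_mult_coprime) auto
    moreover have "d + d * (u * m) + d * j = d * Suc j + (d * u) * m" by (simp add: algebra_simps)
    ultimately have "\<not> m dvd d + d * (u * m) + d * j"
      by (simp only: dvd_add_times_triv_right_iff) simp
    then show "\<not> int m dvd int (d + d * (u * m)) + int (d * j)"
      by (metis int_dvd_int_iff of_nat_add)
  qed
  have "(1 - ratfun_q ^ (m * (d * u + c))) * inverse (1 - ratfun_q ^ (m * (d * (u + 1))))
      \<in> local_ring (cyclotomic m)"
    using d by (intro local_ring_q_power_quotient[OF m0]) simp
  then have "(1 - ratfun_q ^ (m * (d * u + c))) * inverse (1 - ratfun_q ^ (m * (d * (u + 1))))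
      * (P * inverse D) \<in> local_ring (cyclotomic m)"
    by (rule local_ring_mult[OF _ local_ring_mult[OF P D]])
  then show ?thesis
    unfolding num den inverse_mult_distrib by (simp only: mult_ac)
qed

lemma summand_root_local:
  assumes "m > 1" "coprime m d" "d > 0"
  shows "summand_root d (u * m) \<in> local_ring (cyclotomic m)"
proof (induction u)
  case 0
  show ?case by (simp add: summand_root_def)
next
  case (Suc u)
  have "Suc u * m = u * m + m" by simp
  then show ?case
    unfolding summand_root_add[of d "u * m" m, folded \<open>Suc u * m = u * m + m\<close>]
    by (intro local_ring_mult Suc q_pochhammer_block_quotient[OF assms])
qed

text \<open>Modulo Phi_m only the exponents modulo m matter, and \<open>r < m\<close> keeps both
  denominators invertible.\<close>

lemma summand_root_cong:
  assumes m: "m > 1" "coprime m d" and r: "r < m"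
  shows "local_cong (cyclotomic m) (cyclotomic m)
    (q_pochhammer (ratfun_q powi int (1 + d * (u * m))) (ratfun_q ^ d) r
        * inverse (q_pochhammer (ratfun_q powi int (d + d * (u * m))) (ratfun_q ^ d) r))
    (summand_root d r)"
proof -
  have m0: "m > 0" using m by simp
  have ndvd: "\<not> int m dvd int (d + d * (u * m)) + int (d * j)" if "j < r" for u j
  proof -
    have "\<not> m dvd d * Suc j" using that r m by (intro not_dvd_mult_coprime) auto
    moreover have "d + d * (u * m) + d * j = d * Suc j + (d * u) * m" by (simp add: algebra_simps)
    ultimately have "\<not> m dvd d + d * (u * m) + d * j"
      by (simp only: dvd_add_times_triv_right_iff) simp
    then show ?thesis by (metis int_dvd_int_iff of_nat_add)
  qed
  have cong: "[int (a + d * (u * m)) = int (a + d * (0 * m))] (mod int m)" for a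
    unfolding cong_int_iff by (simp add: cong_def mult.assoc[symmetric])
  have unit: "q_pochhammer (ratfun_q powi int (d + d * (u * m))) (ratfun_q ^ d) r \<noteq> 0"
    "inverse (q_pochhammer (ratfun_q powi int (d + d * (u * m))) (ratfun_q ^ d) r)
      \<in> local_ring (cyclotomic m)" for u
    by (rule q_pochhammer_unit[OF m0]; erule ndvd)+
  \<comment> \<open>The unshifted symbols are written with \<open>0 * m\<close>, so that
    \<open>unit\<close> covers both sides, with \<open>u\<close> arbitrary on one and zero on the
    other.\<close>
  have "local_cong (cyclotomic m) (cyclotomic m)
    (q_pochhammer (ratfun_q powi int (1 + d * (u * m))) (ratfun_q ^ d) r
        * inverse (q_pochhammer (ratfun_q powi int (d + d * (u * m))) (ratfun_q ^ d) r))
    (q_pochhammer (ratfun_q powi int (1 + d * (0 * m))) (ratfun_q ^ d) r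
        * inverse (q_pochhammer (ratfun_q powi int (d + d * (0 * m))) (ratfun_q ^ d) r))"
    by (intro local_cong_mult local_cong_inverse q_pochhammer_cong[OF m0] cong unit)
  then show ?thesis
    by (simp only: summand_root_def power_int_of_nat mult_0 mult_0_right add_0_right power_one_right)
qed

text \<open>The q-integer, written as a quotient by the unit 1 - q, and the power of q depend only
  on the index modulo m. The block factor comes entirely from the fourth power of
  \<open>summand_root\<close>.\<close>

lemma summand_shift_cong:
  assumes m: "m > 1" "coprime m d" and d: "d > 0" and r: "r < m"
  shows "local_cong (cyclotomic m) (cyclotomic m) (summand d (u * m + r))
           (summand_root d (u * m) ^ 4 * summand d r)"
proof -
  have m0: "m > 0" using m by simp
  have "\<not> int m dvd 1" using m by auto
  then have q1: "inverse (1 - ratfun_q) \<in> local_ring (cyclotomic m)"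
    using one_minus_ratfun_q_powi_unit(2)[OF m0, of 1] by simp
  have shift: "[a * (u * m + r) = a * r] (mod m)" for a
    by (intro cong_mult cong_refl) (simp add: cong_def)
  have qint: "local_cong (cyclotomic m) (cyclotomic m)
      (q_int ratfun_q (2 * d * (u * m + r) + 1)) (q_int ratfun_q (2 * d * r + 1))"
    unfolding q_int_ratfun_q_eq
    by (intro local_cong_mult local_cong_one_minus local_cong_refl[OF q1] ratfun_q_power_cong[OF m0]
        cong_add shift cong_refl)
  have qpow: "local_cong (cyclotomic m) (cyclotomic m)
      (ratfun_q ^ ((d - 2) * (u * m + r))) (ratfun_q ^ ((d - 2) * r))"
    by (intro ratfun_q_power_cong[OF m0] shift)
  have root: "local_cong (cyclotomic m) (cyclotomic m) (summand_root d (u * m + r))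
      (summand_root d (u * m) * summand_root d r)"
    unfolding summand_root_add[of d "u * m" r]
    by (intro local_cong_mult local_cong_refl summand_root_local summand_root_cong m d r)
  have "local_cong (cyclotomic m) (cyclotomic m) (summand d (u * m + r))
     (q_int ratfun_q (2 * d * r + 1) * (summand_root d (u * m) * summand_root d r) ^ 4
        * ratfun_q ^ ((d - 2) * r))"
    unfolding summand_eq by (intro local_cong_mult local_cong_power qint qpow root)
  then show ?thesis
    unfolding summand_eq power_mult_distrib by (simp only: mult_ac)
qed

lemma sum_lessThan_add:
  fixes f :: "nat \<Rightarrow> 'a::comm_monoid_add"
  shows "(\<Sum>k<i + j. f k) = (\<Sum>k<i. f k) + (\<Sum>k<j. f (i + k))"
  by (induction j) (simp_all add: add.assoc)

lemma full_sum_cong: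
  assumes m: "m > 1" "coprime m d" and d: "d \<ge> 2"
  shows "local_cong (cyclotomic m) (cyclotomic m) (\<Sum>k<t * m. summand d k) 0"
proof -
  obtain N c where N: "N < m" "d * N + 1 = c * m"
    using exists_multiple_minus_1[OF m] by blast
  have d0: "d > 0" using d by simp
  show ?thesis
  proof (induction t)
    case (Suc t)
    have "(\<Sum>k<Suc t * m. summand d k) = (\<Sum>k<t * m. summand d k) + (\<Sum>r<m. summand d (t * m + r))"
      using sum_lessThan_add[of "summand d" "t * m" m] by (simp add: add.commute)
    moreover have "local_cong (cyclotomic m) (cyclotomic m) (\<Sum>r<m. summand d (t * m + r)) 0"
    proof -
      have "local_cong (cyclotomic m) (cyclotomic m) (\<Sum>r<m. summand d (t * m + r))
          (\<Sum>r<m. summand_root d (t * m) ^ 4 * summand d r)"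
        by (intro local_cong_sum summand_shift_cong[OF m d0]) simp
      also have "(\<Sum>r<m. summand_root d (t * m) ^ 4 * summand d r)
          = (\<Sum>r<m. summand d r) * summand_root d (t * m) ^ 4"
        unfolding sum_distrib_right by (intro sum.cong refl mult.commute)
      also have "local_cong (cyclotomic m) (cyclotomic m) \<dots> 0"
        by (intro local_cong_0_mult_right truncated_sum_cong(1)[OF d m N(2,1)]
            local_ring_power summand_root_local m d0)
      finally show ?thesis .
    qed
    ultimately show ?case
      using local_cong_add[OF Suc] by (metis add_0_right)
  qed (simp add: local_cong_refl)
qed

section \<open>Assembling the cyclotomic factors of the modulus\<close>

lemma prod_dvd_of_pairwise_coprime:
  fixes f :: "'b \<Rightarrow> 'a::semiring_gcd"
  assumes "finite A" "\<And>x. x \<in> A \<Longrightarrow> f x dvd y"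
    and "\<And>x x'. x \<in> A \<Longrightarrow> x' \<in> A \<Longrightarrow> x \<noteq> x' \<Longrightarrow> coprime (f x) (f x')"
  shows "prod f A dvd y"
  using assms
proof (induction A rule: finite_induct)
  case (insert a A)
  have "coprime (f a) (prod f A)"
    using insert by (intro prod_coprime_right) auto
  moreover have "f a dvd y" "prod f A dvd y"
    using insert by auto
  ultimately show ?case using insert by (simp add: divides_mult)
qed simp

theorem theorem2p4:
  fixes d n :: nat
  assumes "d > 2" and "n > 0" and "[int n = - 1] (mod int d)"
  shows "ratfun_cong
           (\<Sum>k = 0..n - 1.
              q_int ratfun_q (2 * d * k + 1)
              * (q_pochhammer ratfun_q (ratfun_q ^ d) k ^ 4
                 / q_pochhammer (ratfun_q ^ d) (ratfun_q ^ d) k ^ 4)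
              * ratfun_q ^ ((d - 2) * k))
           0
           (q_int poly_q n * cyclotomic n)"
proof -
  have "int d dvd int (n + 1)"
    using assms(3) by (simp add: cong_iff_dvd_diff add.commute)
  then have "d dvd n + 1" by (simp only: int_dvd_int_iff)
  then obtain s where s: "n + 1 = d * s" by (elim dvdE)
  have "s > 0" using s by (cases s) auto
  \<comment> \<open>The hypothesis \<open>d > 2\<close> yields 3s <= n + 1. The resulting bound 2s -
    1 < n says that the index s - 1 lies below N = n - s, as the second vanishing factor
    requires.\<close>
  have "3 * s \<le> d * s" using assms(1) by (intro mult_right_mono) auto
  then have s_less: "2 * s - 1 < n" "2 * s \<le> n" using s \<open>s > 0\<close> by linarith+
  then have n1: "n > 1" using \<open>s > 0\<close> by linarith
  have "coprime n d"
  proof (rule coprimeI)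
    fix g assume g: "g dvd n" "g dvd d"
    then have "g dvd n + 1" using s by simp
    with g(1) show "is_unit g" using dvd_add_right_iff by blast
  qed
  have d2: "d \<ge> 2" using assms(1) by simp
  define F where "F = fst (quot_of_fract (\<Sum>k<n. summand d k))"
  \<comment> \<open>The modulus is the product of Phi_m over the divisors m > 1 of n, with Phi_n
    counted twice; \<open>e\<close> records these multiplicities.\<close>
  define e where "e m = (if m = n then 2 else 1 :: nat)" for m
  have dvd: "cyclotomic m ^ e m dvd F" if m: "m dvd n" "m \<noteq> 1" for m
  proof (cases "m = n")
    case True
    \<comment> \<open>From n + 1 = ds it follows that d(n - s) + 1 = (d - 1)n, so N = n - s and c =
      d - 1.\<close>
    have "local_cong (cyclotomic n) ((cyclotomic n)\<^sup>2) (\<Sum>k<n. summand d k) 0"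
    proof (rule truncated_sum_cong(2)[OF d2 n1 \<open>coprime n d\<close>])
      have "d * (n - s) + d * s = d * n"
        using s_less(2) by (simp flip: distrib_left)
      moreover have "(d - 1) * n + n = d * n" using d2 by (cases d) auto
      ultimately show "d * (n - s) + 1 = (d - 1) * n"
        using s by linarith
      show "n - s < n" "s - 1 < n - s" using s_less \<open>s > 0\<close> by linarith+
      \<comment> \<open>The choice j = s - 1 makes d(j + 1) - 1 equal to n, which gives the second
        factor Phi_n.\<close>
      have "d * Suc (s - 1) = n + 1" using s \<open>s > 0\<close> by simp
      then have "int (d * Suc (s - 1)) - 1 = int n" by (simp only:)
      then show "int n dvd int (d * Suc (s - 1)) - 1" by simp
    qed
    then show ?thesis
      unfolding F_def True e_def by (simp only: refl if_True) (rule dvd_fst_quot_of_fract)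
  next
    case False
    have "m > 0" using m(1) assms(2) by (rule dvd_pos_nat[rotated])
    then have m1: "m > 1" using m(2) by linarith
    have md: "coprime m d" using \<open>coprime n d\<close> m(1) coprime_divisors[OF m(1) dvd_refl] by blast
    obtain t where "n = m * t" using m(1) by (elim dvdE)
    then have t: "n = t * m" by (simp only: mult.commute)
    have "local_cong (cyclotomic m) (cyclotomic m ^ 1) (\<Sum>k<n. summand d k) 0"
      unfolding t power_one_right by (rule full_sum_cong[OF m1 md d2])
    from dvd_fst_quot_of_fract[OF this] False show ?thesis
      unfolding F_def e_def by (simp only: if_False)
  qed
  have "(\<Prod>m | m dvd n \<and> m \<noteq> 1. cyclotomic m ^ e m) dvd F"
  proof (rule prod_dvd_of_pairwise_coprime)
    show "finite {m. m dvd n \<and> m \<noteq> 1}" using assms(2) by simp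
    show "cyclotomic m ^ e m dvd F" if "m \<in> {m. m dvd n \<and> m \<noteq> 1}" for m
      using dvd that by blast
    show "coprime (cyclotomic m ^ e m) (cyclotomic m' ^ e m')"
      if "m \<in> {m. m dvd n \<and> m \<noteq> 1}" "m' \<in> {m. m dvd n \<and> m \<noteq> 1}" "m \<noteq> m'" for m m'
    proof -
      have "m > 0" "m' > 0" using that assms(2) by (auto intro: dvd_pos_nat)
      then have "coprime (cyclotomic m) (cyclotomic m')"
        using that(3) by (rule coprime_cyclotomic_cyclotomic)
      then show ?thesis by simp
    qed
  qed
  also have "(\<Prod>m | m dvd n \<and> m \<noteq> 1. cyclotomic m ^ e m) = q_int poly_q n * cyclotomic n"
  proof -
    have fin: "finite {m. m dvd n \<and> m \<noteq> 1}" using assms(2) by simp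
    have mem: "n \<in> {m. m dvd n \<and> m \<noteq> 1}" using n1 by simp
    have "(\<Prod>m\<in>{m. m dvd n \<and> m \<noteq> 1} - {n}. cyclotomic m ^ e m)
        = (\<Prod>m\<in>{m. m dvd n \<and> m \<noteq> 1} - {n}. cyclotomic m)"
      by (rule prod.cong) (auto simp: e_def)
    then show ?thesis
      unfolding q_int_poly_q[OF assms(2)] prod.remove[OF fin mem]
      by (simp add: e_def power2_eq_square mult_ac)
  qed
  finally have "q_int poly_q n * cyclotomic n dvd F" .
  moreover have "{0..n - 1} = {..<n}" using assms(2) by auto
  ultimately show ?thesis
    unfolding ratfun_cong_def diff_0_right F_def summand_def by (simp only:)
qed

end
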